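(* Let $r>0$ be the solution of $$ (n_0\wedge n_0^2\varepsilon_0^2r^d)\,r^{2\beta+d}+\sum_{j=1}^m (n_j\wedge n_j^2\varepsilon_j^2r^d)\,r^{2\beta\gamma_j+d}=1 , $$ and let $\hat f$ be the classifier $\hat f(x)=\mathbf 1(\tilde T_{h_{opt,\delta}}(x)\ge0)$ based on the noise-perturbed weighted kernel estimator $\tilde T_h$ defined in the context. Then $$ \sup_{(P_0,\dots,P_m)\in\Pi(\alpha,\beta,\boldsymbol\gamma,\mu)}\mathcal E_0(\hat f)\ \le\ C_*\,r^{\beta(1+\alpha)}\left(\log\left(\frac1{\delta_{\min}}\right)\right)^{\frac{\beta(1+\alpha)}{2\beta\gamma_{\min}+d}}, $$ where $C_*$ is a constant depending on $L,d,\alpha,\beta,\gamma_j$, while $\gamma_{\min}=\min\{1,\gamma_1,\dots,\gamma_m\}$ and $\delta_{\min}=\min\{\delta_0,\dots,\delta_m\}$.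
   Context: Notation: $a\wedge b=\min(a,b)$. Data: there are $m+1$ servers; server $0$ is the target and servers $1,\dots,m$ are sources. Server $j$ holds $n_j$ i.i.d. observations $(X^{(j)}_i,Y^{(j)}_i)\in[0,1]^d\times\{0,1\}$, $1\le i\le n_j$, from $P_j$, independently across servers. $P_j^X$ is the marginal law of $X$ under $P_j$ and $\eta_j(x)=P_j(Y=1\mid X=x)$. Server $j$ has privacy parameters $(\varepsilon_j,\delta_j)$ with $\varepsilon_j>0$, $\delta_j\in(0,1)$. Risk: $R_0(f)=P_0(Y\ne f(X))$, $f_0^*(x)=\mathbf 1\{\eta_0(x)\ge 1/2\}$, and $\mathcal E_0(\hat f)=\mathbb E[R_0(\hat f)]-R_0(f_0^* )$, the expectation being over all data and randomization. Class $\Pi=\Pi(\alpha,\beta,\boldsymbol\gamma,\mu)$: fix $\alpha\ge0$, $0<\beta\le1$ with $\alpha\beta\le d$, constants $L,C_\alpha>0$, exponents $\gamma_j>0$ and constants $C_j>0$ ($1\le j\le m$), $\mu=(g_{\min},g_{\max})$ with $0<g_{\min}<g_{\max}<\infty$, and $c_\mu,r_\mu>0$. $\Pi$ is the set of $(P_0,\dots,P_m)$ such that: (i) for all $1\le j\le m$, $x\in[0,1]^d$: $\mathrm{sign}(\eta_j(x)-\tfrac12)=\mathrm{sign}(\eta_0(x)-\tfrac12)$ and $|\eta_j(x)-\tfrac12|\ge C_j|\eta_0(x)-\tfrac12|^{\gamma_j}$; (ii) $|\eta_0(x)-\eta_0(x')|\le L\|x-x'\|^\beta$ for all $x,x'\in[0,1]^d$;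 (iii) $P_0^X(0\le|\eta_0(X)-\tfrac12|\le t)\le C_\alpha t^\alpha$ for all $t>0$; (iv) all $P_j^X$, $0\le j\le m$, have the same compact support $A\subset[0,1]^d$, which is $(c_\mu,r_\mu)$-regular (i.e. $\lambda(A\cap B(x,s))\ge c_\mu\lambda(B(x,s))$ for all $0<s\le r_\mu$, $x\in A$, with $\lambda$ Lebesgue measure and $B(x,s)$ the Euclidean ball), and each has a Lebesgue density $g_j$ with $g_{\min}\le g_j\le g_{\max}$ on $A$ and $g_j=0$ off $A$. Kernel: $K$ is supported on $[-1,1]^d$, $\int K=1$, $K$ is $L_K$-Lipschitz, $\max K\le c_K$, $\min\{K(t):\|t\|\le1/2\}\ge b_K>0$, and $K$ is positive definite (i.e. $(s,t)\mapsto K(s-t)$ is a positive definite kernel). Classifier: for $h>0$ and $x\in[0,1]^d$ let $T_h^{(j)}(x)=\frac1{n_jh^d}\sum_{i=1}^{n_j}(Y_i^{(j)}-\tfrac12)K\big(\frac{X_i^{(j)}-x}h\big)$, $0\le j\le m$. Let $\xi^{(0)},\dots,\xi^{(m)}$ be independent mean-zero Gaussian processes on $[0,1]^d$, independent of the data, with covariance $\mathrm{Cov}(\xi^{(j)}(s),\xi^{(j)}(t))=K((s-t)/h)$, and $\tilde\xi_h^{(j)}=\frac{\sqrt{2c_K\log(2/\delta_j)}}{n_j\varepsilon_jh^d}\xi^{(j)}$. Let $h_{opt,\delta}$ be the solution $h>0$ of $(n_0\wedge n_0^2\varepsilon_0^2h^d)h^{2\beta+d}+\sum_{j=1}^m(n_j\wedge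 n_j^2\varepsilon_j^2h^d)h^{2\beta\gamma_j+d}=\log(2/\delta_{\min})$. With $\gamma_0:=1$ let $v_j=(n_j\wedge n_j^2\varepsilon_j^2h_{opt,\delta}^d)\,h_{opt,\delta}^{\gamma_j\beta}$ and $u_j=v_j/\sum_{k=0}^mv_k$ for $0\le j\le m$. Then $\tilde T_h(x)=\sum_{j=0}^mu_j\big(T_h^{(j)}(x)+\tilde\xi_h^{(j)}(x)\big)$ and $\hat f(x)=\mathbf 1(\tilde T_{h_{opt,\delta}}(x)\ge0)$.
   Formalization: The kernel K is assumed nonnegative, and the bound is proved for δ_min ≤ Δ with any fixed Δ < 1, the constant C_* being allowed to depend on Δ; without these the claim fails (signed K breaks sign preservation; log(1/δ_min) → 0 as δ_min → 1). *)

theory Defs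
  imports "HOL-Probability.Probability"
begin

section \<open>Distributions on the unit cube with binary labels\<close>

text \<open>
  The dimension is the cardinality of the index type. Labels are Booleans, with True for 1 and
  False for 0.
\<close>

abbreviation unit_cube :: "(real ^ 'd) set" where
  "unit_cube \<equiv> cbox 0 1"

abbreviation cube_borel :: "(real ^ 'd) measure" where
  "cube_borel \<equiv> restrict_space borel unit_cube"

definition labelled_law :: "((real ^ 'd) \<times> bool) measure \<Rightarrow> bool" where
  "labelled_law P \<longleftrightarrow> prob_space P \<and> sets P = sets (cube_borel \<Otimes>\<^sub>M count_space UNIV)"

definition covariate_law :: "((real ^ 'd) \<times> bool) measure \<Rightarrow> (real ^ 'd) measure" where
  "covariate_law P = distr P borel fst"

text \<open>
  The conditional probability of the label 1 given the covariate is determined only up to a null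
  set of the covariate law, so being a regression function is a property of a function.
\<close>

definition regression_version ::
    "((real ^ 'd) \<times> bool) measure \<Rightarrow> (real ^ 'd \<Rightarrow> real) \<Rightarrow> bool" where
  "regression_version P \<eta> \<longleftrightarrow>
     \<eta> \<in> borel_measurable cube_borel \<and>
     (\<forall>x\<in>unit_cube. 0 \<le> \<eta> x \<and> \<eta> x \<le> 1) \<and>
     (AE z in P. real_cond_exp P (vimage_algebra (space P) fst cube_borel)
                   (\<lambda>z. of_bool (snd z)) z = \<eta> (fst z))"

definition risk :: "((real ^ 'd) \<times> bool) measure \<Rightarrow> (real ^ 'd \<Rightarrow> bool) \<Rightarrow> real" where
  "risk P f = measure P {z \<in> space P. snd z \<noteq> f (fst z)}"

text \<open>
  The choice of the version is immaterial for the risk of the Bayes classifier, since two versions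
  agree almost everywhere.
\<close>

definition bayes_classifier :: "((real ^ 'd) \<times> bool) measure \<Rightarrow> real ^ 'd \<Rightarrow> bool" where
  "bayes_classifier P x \<longleftrightarrow> (SOME \<eta>. regression_version P \<eta>) x \<ge> 1 / 2"


section \<open>The class of target and source distributions\<close>

definition measure_support :: "'a::topological_space measure \<Rightarrow> 'a set" where
  "measure_support M = {x. \<forall>U. open U \<and> x \<in> U \<longrightarrow> emeasure M U > 0}"

definition regular_set :: "real \<Rightarrow> real \<Rightarrow> 'a::euclidean_space set \<Rightarrow> bool" where
  "regular_set c\<^sub>\<mu> r\<^sub>\<mu> A \<longleftrightarrow>
     (\<forall>x\<in>A. \<forall>s. 0 < s \<and> s \<le> r\<^sub>\<mu> \<longrightarrow>
        measure lborel (A \<inter> ball x s) \<ge> c\<^sub>\<mu> * measure lborel (ball x s))"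

text \<open>
  The conditions on the regression functions are pointwise on the whole cube, hence they are
  required of some choice of versions. Server 0 is the target, servers 1 to m are the sources.
\<close>

definition transfer_class ::
    "nat \<Rightarrow> real \<Rightarrow> real \<Rightarrow> (nat \<Rightarrow> real) \<Rightarrow> real \<Rightarrow> real \<Rightarrow> (nat \<Rightarrow> real) \<Rightarrow>
     real \<Rightarrow> real \<Rightarrow> real \<Rightarrow> real \<Rightarrow> (nat \<Rightarrow> ((real ^ 'd) \<times> bool) measure) set" where
  "transfer_class m \<alpha> \<beta> \<gamma> L C\<^sub>\<alpha> C g\<^sub>m\<^sub>i\<^sub>n g\<^sub>m\<^sub>a\<^sub>x c\<^sub>\<mu> r\<^sub>\<mu> = {P.
     (\<forall>j\<le>m. labelled_law (P j)) \<and>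
     (\<exists>\<eta>. (\<forall>j\<le>m. regression_version (P j) (\<eta> j)) \<and>
        (\<forall>j\<in>{1..m}. \<forall>x\<in>unit_cube.
            sgn (\<eta> j x - 1 / 2) = sgn (\<eta> 0 x - 1 / 2) \<and>
            \<bar>\<eta> j x - 1 / 2\<bar> \<ge> C j * \<bar>\<eta> 0 x - 1 / 2\<bar> powr \<gamma> j) \<and>
        (\<forall>x\<in>unit_cube. \<forall>x'\<in>unit_cube. \<bar>\<eta> 0 x - \<eta> 0 x'\<bar> \<le> L * norm (x - x') powr \<beta>) \<and>
        (\<forall>t>0. measure (covariate_law (P 0))
                  {x \<in> unit_cube. 0 \<le> \<bar>\<eta> 0 x - 1 / 2\<bar> \<and> \<bar>\<eta> 0 x - 1 / 2\<bar> \<le> t}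
                \<le> C\<^sub>\<alpha> * t powr \<alpha>)) \<and>
     (\<exists>A. compact A \<and> A \<subseteq> unit_cube \<and> regular_set c\<^sub>\<mu> r\<^sub>\<mu> A \<and>
        (\<forall>j\<le>m. measure_support (covariate_law (P j)) = A \<and>
           (\<exists>g \<in> borel_measurable borel.
              covariate_law (P j) = density lborel (\<lambda>x. ennreal (g x)) \<and>
              (\<forall>x\<in>A. g\<^sub>m\<^sub>i\<^sub>n \<le> g x \<and> g x \<le> g\<^sub>m\<^sub>a\<^sub>x) \<and> (\<forall>x. x \<notin> A \<longrightarrow> g x = 0))))}"


section \<open>Kernel and Gaussian noise processes\<close>

definition positive_definite_kernel :: "('a \<Rightarrow> 'a \<Rightarrow> real) \<Rightarrow> bool" where
  "positive_definite_kernel k \<longleftrightarrow>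
     (\<forall>s t. k s t = k t s) \<and>
     (\<forall>S a. finite S \<longrightarrow> (\<Sum>s\<in>S. \<Sum>t\<in>S. a s * a t * k s t) \<ge> 0)"

text \<open>
  The smoothing kernel takes nonnegative values. Positive definiteness does not imply this, and a
  kernel with negative values need not preserve the common sign of the regression functions minus
  1/2, because the regression functions of the sources are not assumed to be smooth.
\<close>

definition smoothing_kernel :: "real \<Rightarrow> real \<Rightarrow> real \<Rightarrow> (real ^ 'd \<Rightarrow> real) \<Rightarrow> bool" where
  "smoothing_kernel L\<^sub>K c\<^sub>K b\<^sub>K K \<longleftrightarrow>
     (\<forall>t. 0 \<le> K t) \<and>
     (\<forall>t. t \<notin> cbox (- 1) 1 \<longrightarrow> K t = 0) \<and>
     has_bochner_integral lborel K 1 \<and>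
     L\<^sub>K-lipschitz_on UNIV K \<and>
     (\<forall>t. K t \<le> c\<^sub>K) \<and>
     (\<forall>t. norm t \<le> 1 / 2 \<longrightarrow> b\<^sub>K \<le> K t) \<and>
     positive_definite_kernel (\<lambda>s t. K (s - t))"

text \<open>Point masses count as normal laws, with standard deviation 0.\<close>

definition normal_law :: "real \<Rightarrow> real \<Rightarrow> real measure" where
  "normal_law \<mu> \<sigma> =
     (if \<sigma> = 0 then return borel \<mu> else density lborel (\<lambda>x. ennreal (normal_density \<mu> \<sigma> x)))"

definition centered_gaussian_process ::
    "'w measure \<Rightarrow> 'a set \<Rightarrow> ('a \<Rightarrow> 'a \<Rightarrow> real) \<Rightarrow> ('w \<Rightarrow> 'a \<Rightarrow> real) \<Rightarrow> bool" where
  "centered_gaussian_process N T k \<xi> \<longleftrightarrow>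
     (\<forall>t\<in>T. (\<lambda>\<omega>. \<xi> \<omega> t) \<in> borel_measurable N) \<and>
     (\<forall>S a. finite S \<and> S \<subseteq> T \<longrightarrow>
        (\<exists>\<mu> \<sigma>. \<sigma> \<ge> 0 \<and> distr N borel (\<lambda>\<omega>. \<Sum>s\<in>S. a s * \<xi> \<omega> s) = normal_law \<mu> \<sigma>)) \<and>
     (\<forall>t\<in>T. (\<integral>\<omega>. \<xi> \<omega> t \<partial>N) = 0) \<and>
     (\<forall>s\<in>T. \<forall>t\<in>T. (\<integral>\<omega>. \<xi> \<omega> s * \<xi> \<omega> t \<partial>N) = k s t)"

text \<open>
  Joint measurability in the sample point and the location is what makes the risk of the randomized
  classifier, and its expectation, well defined. It holds for the continuous version of the process.
\<close>

definition noise_processes ::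
    "nat \<Rightarrow> (real ^ 'd \<Rightarrow> real) \<Rightarrow> real \<Rightarrow> 'w measure \<Rightarrow> (nat \<Rightarrow> 'w \<Rightarrow> real ^ 'd \<Rightarrow> real) \<Rightarrow> bool"
where
  "noise_processes m K h N \<xi> \<longleftrightarrow>
     prob_space N \<and>
     (\<forall>j\<le>m. centered_gaussian_process N unit_cube (\<lambda>s t. K ((s - t) /\<^sub>R h)) (\<xi> j)) \<and>
     (\<forall>j\<le>m. (\<lambda>(\<omega>, x). \<xi> j \<omega> x) \<in> borel_measurable (N \<Otimes>\<^sub>M cube_borel)) \<and>
     prob_space.indep_vars N (\<lambda>_. PiM unit_cube (\<lambda>_. borel))
       (\<lambda>j \<omega>. restrict (\<xi> j \<omega>) unit_cube) {..m}"


section \<open>The weighted private classifier\<close>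

definition effective_size :: "nat \<Rightarrow> nat \<Rightarrow> real \<Rightarrow> real \<Rightarrow> real" where
  "effective_size d n \<epsilon> s = min (real n) ((real n)\<^sup>2 * \<epsilon>\<^sup>2 * s ^ d)"

definition rate_function ::
    "nat \<Rightarrow> nat \<Rightarrow> real \<Rightarrow> (nat \<Rightarrow> real) \<Rightarrow> (nat \<Rightarrow> nat) \<Rightarrow> (nat \<Rightarrow> real) \<Rightarrow> real \<Rightarrow> real" where
  "rate_function d m \<beta> \<gamma> n \<epsilon> s =
     effective_size d (n 0) (\<epsilon> 0) s * s powr (2 * \<beta> + real d) +
     (\<Sum>j=1..m. effective_size d (n j) (\<epsilon> j) s * s powr (2 * \<beta> * \<gamma> j + real d))"

text \<open>The exponent attached to the target is 1, whatever the value of the given function at 0.\<close>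

definition raw_weight ::
    "nat \<Rightarrow> real \<Rightarrow> (nat \<Rightarrow> real) \<Rightarrow> (nat \<Rightarrow> nat) \<Rightarrow> (nat \<Rightarrow> real) \<Rightarrow> real \<Rightarrow> nat \<Rightarrow> real" where
  "raw_weight d \<beta> \<gamma> n \<epsilon> h j =
     effective_size d (n j) (\<epsilon> j) h * h powr ((if j = 0 then 1 else \<gamma> j) * \<beta>)"

definition server_weight ::
    "nat \<Rightarrow> nat \<Rightarrow> real \<Rightarrow> (nat \<Rightarrow> real) \<Rightarrow> (nat \<Rightarrow> nat) \<Rightarrow> (nat \<Rightarrow> real) \<Rightarrow> real \<Rightarrow> nat \<Rightarrow> real"
where
  "server_weight d m \<beta> \<gamma> n \<epsilon> h j =
     raw_weight d \<beta> \<gamma> n \<epsilon> h j / (\<Sum>k\<le>m. raw_weight d \<beta> \<gamma> n \<epsilon> h k)"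

text \<open>A data set maps the pair (j, i) to the i-th labelled observation of server j.\<close>

definition local_statistic ::
    "(real ^ 'd \<Rightarrow> real) \<Rightarrow> (nat \<Rightarrow> nat) \<Rightarrow> real \<Rightarrow> nat \<Rightarrow>
     (nat \<times> nat \<Rightarrow> (real ^ 'd) \<times> bool) \<Rightarrow> real ^ 'd \<Rightarrow> real" where
  "local_statistic K n h j D x =
     1 / (real (n j) * h ^ CARD('d)) *
     (\<Sum>i=1..n j. (of_bool (snd (D (j, i))) - 1 / 2) * K ((fst (D (j, i)) - x) /\<^sub>R h))"

definition noise_scale ::
    "nat \<Rightarrow> real \<Rightarrow> (nat \<Rightarrow> nat) \<Rightarrow> (nat \<Rightarrow> real) \<Rightarrow> (nat \<Rightarrow> real) \<Rightarrow> real \<Rightarrow> nat \<Rightarrow> real" where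
  "noise_scale d c\<^sub>K n \<epsilon> \<delta> h j =
     sqrt (2 * c\<^sub>K * ln (2 / \<delta> j)) / (real (n j) * \<epsilon> j * h ^ d)"

text \<open>The last three arguments are the data, the noise and the location.\<close>

definition private_classifier ::
    "nat \<Rightarrow> real \<Rightarrow> (nat \<Rightarrow> real) \<Rightarrow> real \<Rightarrow> (real ^ 'd \<Rightarrow> real) \<Rightarrow>
     (nat \<Rightarrow> nat) \<Rightarrow> (nat \<Rightarrow> real) \<Rightarrow> (nat \<Rightarrow> real) \<Rightarrow> real \<Rightarrow>
     (nat \<times> nat \<Rightarrow> (real ^ 'd) \<times> bool) \<Rightarrow> (nat \<Rightarrow> real ^ 'd \<Rightarrow> real) \<Rightarrow> real ^ 'd \<Rightarrow> bool" where
  "private_classifier m \<beta> \<gamma> c\<^sub>K K n \<epsilon> \<delta> h D \<xi> x \<longleftrightarrow>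
     (\<Sum>j\<le>m. server_weight CARD('d) m \<beta> \<gamma> n \<epsilon> h j *
        (local_statistic K n h j D x + noise_scale CARD('d) c\<^sub>K n \<epsilon> \<delta> h j * \<xi> j x)) \<ge> 0"

definition data_law ::
    "nat \<Rightarrow> (nat \<Rightarrow> nat) \<Rightarrow> (nat \<Rightarrow> ((real ^ 'd) \<times> bool) measure) \<Rightarrow>
     (nat \<times> nat \<Rightarrow> (real ^ 'd) \<times> bool) measure" where
  "data_law m n P = PiM (SIGMA j:{..m}. {1..n j}) (\<lambda>(j, i). P j)"

text \<open>
  The classifier may depend on the data and on the sample point of the noise space; the product
  measure makes the noise independent of the data.
\<close>

definition excess_risk ::
    "nat \<Rightarrow> (nat \<Rightarrow> nat) \<Rightarrow> 'w measure \<Rightarrow>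
     ((nat \<times> nat \<Rightarrow> (real ^ 'd) \<times> bool) \<Rightarrow> 'w \<Rightarrow> real ^ 'd \<Rightarrow> bool) \<Rightarrow>
     (nat \<Rightarrow> ((real ^ 'd) \<times> bool) measure) \<Rightarrow> real" where
  "excess_risk m n N f P =
     (\<integral>(D, \<omega>). risk (P 0) (f D \<omega>) \<partial>(data_law m n P \<Otimes>\<^sub>M N)) - risk (P 0) (bayes_classifier (P 0))"

end

theory Submission
  imports Defs
begin

text \<open>
  The excess risk is the integral over the target covariate of twice the margin
  \<open>\<zeta> x = \<bar>\<eta> 0 x - 1 / 2\<bar>\<close> times the probability that the private classifier decides at \<open>x\<close> against the Bayes
  rule (\<open>excess_risk_eq\<close>). So the question is how fast this probability decays in the margin.

  Let \<open>\<Lambda> = ln (2 / \<delta>\<^sub>m\<^sub>i\<^sub>n)\<close>, let \<open>h\<close> solve the rate equation at level \<open>\<Lambda>\<close>, let \<open>\<gamma> 0 = 1\<close>,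
  and let \<open>\<gamma>\<^sub>m\<^sub>i\<^sub>n\<close> be the least exponent. With the effective
  sizes \<open>N j = min (n j) ((n j)\<^sup>2 * (\<epsilon> j)\<^sup>2 * h ^ d)\<close> the weights are proportional to
  \<open>v j = N j * h powr (\<beta> * \<gamma> j)\<close>, and the rate equation says that the sum of
  \<open>v j * h powr (\<beta> * \<gamma> j)\<close> is \<open>\<Lambda> / h ^ d\<close>. Suppose that \<open>\<zeta> x\<close> is a large multiple \<open>y\<close> of \<open>h powr \<beta>\<close>. By
  smoothness the target regression function stays on one side of \<open>1 / 2\<close> on the kernel window around \<open>x\<close>,
  and hence so do all sources, each by a margin of order \<open>(y * h powr \<beta>) powr \<gamma> j\<close>; as the kernel is
  nonnegative, all local means have the correct sign. The weighted signal is therefore at least of order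
  \<open>y powr \<gamma>\<^sub>m\<^sub>i\<^sub>n * \<Lambda> / h ^ d\<close>. The privacy noise, weighted by \<open>v\<close>, has standard deviation of order \<open>\<Lambda> / h ^ d\<close>,
  because \<open>N j\<close> is at most the second member of its minimum, and the sampling error has standard
  deviation of order \<open>sqrt \<Lambda> / h ^ d\<close>, because \<open>N j\<close> is at most the first. A Chernoff bound with the
  single parameter \<open>h ^ d / (c\<^sub>K * \<Lambda>)\<close> then gives an error probability of at most a constant times
  \<open>exp (- c * y powr \<gamma>\<^sub>m\<^sub>i\<^sub>n)\<close> (\<open>private_misclassification_le\<close>, \<open>misclassification_tail\<close>).

  Peeling over dyadic values of \<open>y\<close> and the margin condition turn this into an excess risk of order
  \<open>h powr (\<beta> * (1 + \<alpha>))\<close> (\<open>margin_integral_le\<close>, \<open>excess_risk_le_bandwidth\<close>); for \<open>h\<close> above a fixed scale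
  this order is a constant and the bound is trivial. Finally \<open>h\<close> and \<open>r\<close> solve the same equation at the
  levels \<open>\<Lambda>\<close> and 1, and each summand of the rate function grows at least like the power
  \<open>2 * \<beta> * \<gamma>\<^sub>m\<^sub>i\<^sub>n + d\<close>, so \<open>h\<close> is at most \<open>r\<close> times the corresponding root of \<open>\<Lambda>\<close>
  (\<open>solution_le\<close>, \<open>bandwidth_powr_le\<close>). This root produces the logarithmic factor.
\<close>


section \<open>Exponential inequalities\<close>

lemma exp_minus_le_quadratic:
  fixes y :: real
  assumes "\<bar>y\<bar> \<le> 1"
  shows "exp (- y) \<le> 1 - y + y\<^sup>2"
proof (cases "y \<le> 0")
  case True
  then show ?thesis using exp_bound[of "- y"] assms by simp
next
  case False
  then have "1 + y \<le> exp y" by (intro exp_ge_add_one_self_aux) simp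
  then have "exp (- y) \<le> 1 / (1 + y)"
    using False by (simp add: exp_minus divide_simps)
  also have "1 / (1 + y) \<le> 1 - y + y\<^sup>2"
  proof -
    have "(1 - y + y\<^sup>2) * (1 + y) = 1 + y ^ 3"
      by (simp add: algebra_simps power2_eq_square power3_eq_cube)
    then show ?thesis using False by (simp add: divide_simps)
  qed
  finally show ?thesis .
qed

text \<open>
  The maximum of \<open>u powr p * exp (- u)\<close> is at \<open>u = p\<close>; the factor \<open>exp (- p)\<close> is dropped.
\<close>

lemma powr_le_exp:
  fixes u p :: real
  assumes "0 \<le> u" "0 < p"
  shows "u powr p \<le> p powr p * exp u"
proof (cases "u = 0")
  case False
  then have u: "u > 0" using assms by simp
  have "ln (u / p) \<le> u / p"
    using ln_le_minus_one[of "u / p"] u assms by simp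
  then have "p * ln (u / p) \<le> u" using assms by (simp add: field_simps)
  then have "p * ln u \<le> p * ln p + u" using u assms by (simp add: ln_div algebra_simps)
  then have "exp (p * ln u) \<le> exp (p * ln p + u)" by simp
  then show ?thesis using u assms by (simp add: powr_def exp_add)
qed auto

text \<open>
  Turns the stretched exponential tail of the misclassification probability into a polynomial tail of
  any prescribed order.
\<close>

lemma stretched_exp_times_powr_le:
  fixes y :: real
  assumes "0 < c" "0 < \<gamma>" "0 < p" "0 \<le> y"
  shows "exp (- (c * y powr \<gamma>)) * y powr p \<le> (p / (\<gamma> * c)) powr (p / \<gamma>)"
proof -
  let ?u = "c * y powr \<gamma>"
  have "(c * y powr \<gamma>) powr (p / \<gamma>) = c powr (p / \<gamma>) * y powr p"
    using assms by (simp add: powr_mult powr_powr)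
  then have "c powr (p / \<gamma>) * y powr p \<le> (p / \<gamma>) powr (p / \<gamma>) * exp ?u"
    using powr_le_exp[of ?u "p / \<gamma>"] assms by simp
  then have "y powr p * exp (- ?u) \<le> (p / \<gamma>) powr (p / \<gamma>) / c powr (p / \<gamma>)"
    using assms by (simp add: exp_minus divide_simps mult.commute)
  also have "\<dots> = (p / (\<gamma> * c)) powr (p / \<gamma>)"
    using assms by (simp add: powr_divide[symmetric])
  finally show ?thesis by (simp add: mult.commute)
qed

text \<open>
  A one-sided Bernstein bound: for a bounded variable the exponential moment at a small parameter is
  governed by the first two moments. The mean enters only through a lower bound, since in the
  application it is the signal, and the second moment only through an upper bound.
\<close>

lemma (in prob_space) exp_moment_le:
  fixes W :: "'a \<Rightarrow> real"
  assumes [measurable]: "W \<in> borel_measurable M"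
    and W: "\<And>z. z \<in> space M \<Longrightarrow> \<bar>W z\<bar> \<le> B" and t: "0 \<le> t" "t * B \<le> 1"
    and S: "S \<le> (\<integral>z. W z \<partial>M)" and V: "(\<integral>z. (W z)\<^sup>2 \<partial>M) \<le> V"
  shows "(\<integral>\<^sup>+z. ennreal (exp (- (t * W z))) \<partial>M) \<le> ennreal (exp (- (t * S) + t\<^sup>2 * V))"
proof -
  have b: "\<bar>t * W z\<bar> \<le> 1" if "z \<in> space M" for z
    using W[OF that] t mult_left_mono[of "\<bar>W z\<bar>" B t] by (simp add: abs_mult)
  have iW: "integrable M W"
    by (rule integrable_const_bound[where B = B]) (auto simp: W)
  have B0: "0 \<le> B" using W not_empty by (meson abs_ge_zero all_not_in_conv order_trans)
  have iW2: "integrable M (\<lambda>z. (W z)\<^sup>2)"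
    by (rule integrable_const_bound[where B = "B\<^sup>2"])
      (auto intro!: AE_I2 W abs_le_square_iff[THEN iffD1] simp: B0)
  have iE: "integrable M (\<lambda>z. exp (- (t * W z)))"
    by (rule integrable_const_bound[where B = "exp 1"]) (use b in \<open>force intro!: AE_I2 simp: abs_le_iff\<close>)+
  \<comment> \<open>The quadratic bound on the exponential applies because \<open>t * B \<le> 1\<close>.\<close>
  have "(\<integral>z. exp (- (t * W z)) \<partial>M) \<le> (\<integral>z. 1 - t * W z + t\<^sup>2 * (W z)\<^sup>2 \<partial>M)"
    using iW iW2 exp_minus_le_quadratic[OF b]
    by (intro integral_mono iE) (auto simp: power_mult_distrib)
  also have "\<dots> = 1 - t * (\<integral>z. W z \<partial>M) + t\<^sup>2 * (\<integral>z. (W z)\<^sup>2 \<partial>M)"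
    using iW iW2 by (simp add: prob_space)
  also have "\<dots> \<le> 1 + (- (t * S) + t\<^sup>2 * V)"
    using mult_left_mono[OF S t(1)] mult_left_mono[OF V, of "t\<^sup>2"] by simp
  also have "\<dots> \<le> exp (- (t * S) + t\<^sup>2 * V)" by (rule exp_ge_add_one_self)
  finally show ?thesis
    using iE by (simp add: nn_integral_eq_integral ennreal_leI)
qed


section \<open>Gaussian processes\<close>

lemma nn_integral_exp_normal_law:
  assumes "\<sigma> \<ge> 0"
  shows "(\<integral>\<^sup>+y. ennreal (exp (s * y)) \<partial>normal_law 0 \<sigma>) = ennreal (exp (s\<^sup>2 * \<sigma>\<^sup>2 / 2))"
proof (cases "\<sigma> = 0")
  case True
  then show ?thesis by (simp add: normal_law_def nn_integral_return)
next
  case False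
  with assms have s: "\<sigma> > 0" by simp
  \<comment> \<open>Completing the square turns the tilted density into a shifted one.\<close>
  have e: "normal_density 0 \<sigma> y * exp (s * y) = exp (s\<^sup>2 * \<sigma>\<^sup>2 / 2) * normal_density (s * \<sigma>\<^sup>2) \<sigma> y" for y
  proof -
    have "s * y - y\<^sup>2 / (2 * \<sigma>\<^sup>2) = s\<^sup>2 * \<sigma>\<^sup>2 / 2 - (y - s * \<sigma>\<^sup>2)\<^sup>2 / (2 * \<sigma>\<^sup>2)"
      using s by (simp add: field_simps power2_eq_square)
    then have "exp (- y\<^sup>2 / (2 * \<sigma>\<^sup>2)) * exp (s * y) =
        exp (s\<^sup>2 * \<sigma>\<^sup>2 / 2) * exp (- (y - s * \<sigma>\<^sup>2)\<^sup>2 / (2 * \<sigma>\<^sup>2))"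
      unfolding exp_add[symmetric] by (simp add: algebra_simps)
    then show ?thesis by (simp add: normal_density_def)
  qed
  have n: "(\<integral>\<^sup>+y. ennreal (normal_density (s * \<sigma>\<^sup>2) \<sigma> y) \<partial>lborel) = 1"
    using prob_space.emeasure_space_1[OF prob_space_normal_density[OF s, of "s * \<sigma>\<^sup>2"]]
    by (simp add: emeasure_density)
  have "(\<integral>\<^sup>+y. ennreal (exp (s * y)) \<partial>normal_law 0 \<sigma>) =
      (\<integral>\<^sup>+y. ennreal (normal_density 0 \<sigma> y * exp (s * y)) \<partial>lborel)"
    using False by (simp add: normal_law_def nn_integral_density ennreal_mult)
  also have "\<dots> = ennreal (exp (s\<^sup>2 * \<sigma>\<^sup>2 / 2))"
    unfolding e using n by (simp add: ennreal_mult nn_integral_cmult)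
  finally show ?thesis .
qed

lemma normal_law_moments:
  assumes "\<sigma> \<ge> 0"
  shows "(\<integral>y. y \<partial>normal_law \<mu> \<sigma>) = \<mu>"
    and "\<mu> = 0 \<Longrightarrow> (\<integral>y. y * y \<partial>normal_law \<mu> \<sigma>) = \<sigma>\<^sup>2"
proof -
  show "(\<integral>y. y \<partial>normal_law \<mu> \<sigma>) = \<mu>"
  proof (cases "\<sigma> = 0")
    case False
    with assms have s: "\<sigma> > 0" by simp
    show ?thesis using False integral_normal_moment_nz_1[OF s, of \<mu>]
      by (simp add: normal_law_def integral_density)
  qed (simp add: normal_law_def integral_return)
  show "(\<integral>y. y * y \<partial>normal_law \<mu> \<sigma>) = \<sigma>\<^sup>2" if "\<mu> = 0"
  proof (cases "\<sigma> = 0")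
    case False
    with assms have s: "\<sigma> > 0" by simp
    show ?thesis using False that integral_normal_moment_even[OF s, of 0 1]
      by (simp add: normal_law_def integral_density power2_eq_square)
  qed (simp add: normal_law_def integral_return that)
qed

text \<open>
  Only the marginal law at one location enters: it is normal, its mean is 0, and its variance is
  the value of the covariance on the diagonal.
\<close>

lemma gaussian_process_exp_moment:
  assumes "centered_gaussian_process N T k \<xi>" and x: "x \<in> T"
  shows "(\<integral>\<^sup>+\<omega>. ennreal (exp (s * \<xi> \<omega> x)) \<partial>N) = ennreal (exp (s\<^sup>2 * k x x / 2))"
proof -
  note G = assms(1)[unfolded centered_gaussian_process_def]
  have [measurable]: "(\<lambda>\<omega>. \<xi> \<omega> x) \<in> borel_measurable N" using G x by blast
  obtain \<mu> \<sigma> where s: "\<sigma> \<ge> 0"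
    and "distr N borel (\<lambda>\<omega>. \<Sum>t\<in>{x}. 1 * \<xi> \<omega> t) = normal_law \<mu> \<sigma>"
    using conjunct1[OF conjunct2[OF G], THEN spec[of _ "{x}"], THEN spec[of _ "\<lambda>_. 1"]] x
    by auto
  then have D: "distr N borel (\<lambda>\<omega>. \<xi> \<omega> x) = normal_law \<mu> \<sigma>" by simp
  have "\<mu> = (\<integral>y. y \<partial>distr N borel (\<lambda>\<omega>. \<xi> \<omega> x))"
    unfolding D by (simp add: normal_law_moments s)
  also have "\<dots> = 0" using G x by (simp add: integral_distr)
  finally have mu: "\<mu> = 0" .
  have "\<sigma>\<^sup>2 = (\<integral>y. y * y \<partial>distr N borel (\<lambda>\<omega>. \<xi> \<omega> x))"
    unfolding D by (simp add: normal_law_moments s mu)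
  also have "\<dots> = k x x" using G x by (simp add: integral_distr)
  finally have sg: "\<sigma>\<^sup>2 = k x x" .
  have "(\<integral>\<^sup>+\<omega>. ennreal (exp (s * \<xi> \<omega> x)) \<partial>N) =
      (\<integral>\<^sup>+y. ennreal (exp (s * y)) \<partial>distr N borel (\<lambda>\<omega>. \<xi> \<omega> x))"
    by (simp add: nn_integral_distr)
  then show ?thesis unfolding D mu using nn_integral_exp_normal_law[OF s] sg by simp
qed


section \<open>Regression functions and the excess risk\<close>

lemma labelled_law_facts:
  fixes P :: "((real ^ 'd) \<times> bool) measure"
  assumes "labelled_law P"
  shows "prob_space P" "space P = unit_cube \<times> UNIV"
    "fst \<in> measurable P cube_borel" "fst \<in> borel_measurable P"
    "snd \<in> measurable P (count_space UNIV)"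
proof -
  have s: "sets P = sets (cube_borel \<Otimes>\<^sub>M count_space UNIV)"
    and "prob_space P" using assms by (auto simp: labelled_law_def)
  then show "prob_space P" by simp
  show "space P = unit_cube \<times> UNIV"
    using sets_eq_imp_space_eq[OF s] by (simp add: space_pair_measure space_restrict_space)
  show f: "fst \<in> measurable P cube_borel" "snd \<in> measurable P (count_space UNIV)"
    unfolding measurable_cong_sets[OF s refl] by simp_all
  show "fst \<in> borel_measurable P"
    using measurable_restrict_space2_iff f(1) by blast
qed

text \<open>
  The form in which the conditional expectation is used: under the integral against a function of
  the covariate, the label may be replaced by the regression function.
\<close>

lemma regression_version_integral:
  fixes P :: "((real ^ 'd) \<times> bool) measure"
  assumes P: "labelled_law P" and eta: "regression_version P \<eta>"
    and phi: "\<phi> \<in> borel_measurable cube_borel" "\<And>x. x \<in> unit_cube \<Longrightarrow> \<bar>\<phi> x\<bar> \<le> B"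
  shows "(\<integral>z. \<phi> (fst z) * of_bool (snd z) \<partial>P) = (\<integral>z. \<phi> (fst z) * \<eta> (fst z) \<partial>P)"
proof -
  note PF = labelled_law_facts[OF P]
  note [measurable] = PF(3,5) phi(1)
  have [measurable]: "\<eta> \<in> borel_measurable cube_borel"
    using eta by (simp add: regression_version_def)
  interpret prob_space P by (rule PF)
  define F where "F = vimage_algebra (space P) fst (cube_borel :: (real ^ 'd) measure)"
  have sub: "subalgebra P F"
  proof -
    have "sets F = {fst -` A \<inter> space P |A. A \<in> sets (cube_borel :: (real ^ 'd) measure)}"
      unfolding F_def by (rule sets_vimage_algebra2) (auto simp: PF(2) space_restrict_space)
    then show ?thesis
      using measurable_sets[OF PF(3)] by (auto simp: subalgebra_def F_def)
  qed
  interpret finite_measure_subalgebra P F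
    by standard (rule sub)
  have fF: "fst \<in> measurable F cube_borel"
    unfolding F_def by (rule measurable_vimage_algebra1) (auto simp: PF(2) space_restrict_space)
  have pF: "(\<lambda>z. \<phi> (fst z)) \<in> borel_measurable F"
    by (rule measurable_compose[OF fF phi(1)])
  have i: "integrable P (\<lambda>z. \<phi> (fst z) * of_bool (snd z))"
    by (rule integrable_const_bound[where B = B])
      (use phi(2) in \<open>force intro!: AE_I2 simp: PF(2) abs_mult intro: order_trans[OF abs_ge_zero]\<close>)+
  have "(\<integral>z. \<phi> (fst z) * of_bool (snd z) \<partial>P) =
      (\<integral>z. \<phi> (fst z) * real_cond_exp P F (\<lambda>z. of_bool (snd z)) z \<partial>P)"
    by (rule real_cond_exp_intg(2)[symmetric, OF i pF]) measurable
  also have "\<dots> = (\<integral>z. \<phi> (fst z) * \<eta> (fst z) \<partial>P)"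
    using eta unfolding regression_version_def F_def[symmetric]
    by (intro integral_cong_AE) (auto simp: F_def[symmetric])
  finally show ?thesis .
qed

text \<open>
  Conditionally on the covariate, predicting 0 costs \<open>\<eta>\<close> and predicting 1 costs \<open>1 - \<eta>\<close>.
\<close>

lemma risk_eq:
  fixes P :: "((real ^ 'd) \<times> bool) measure"
  assumes P: "labelled_law P" and eta: "regression_version P \<eta>"
    and f[measurable]: "f \<in> measurable cube_borel (count_space UNIV)"
  shows "risk P f = (\<integral>z. \<eta> (fst z) + (1 - 2 * \<eta> (fst z)) * of_bool (f (fst z)) \<partial>P)"
proof -
  note PF = labelled_law_facts[OF P]
  note [measurable] = PF(3,5)
  have [measurable]: "\<eta> \<in> borel_measurable cube_borel"
    and eb: "\<And>x. x \<in> unit_cube \<Longrightarrow> 0 \<le> \<eta> x \<and> \<eta> x \<le> 1"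
    using eta by (auto simp: regression_version_def)
  interpret prob_space P by (rule PF)
  have i1: "integrable P (\<lambda>z. of_bool (f (fst z)) :: real)"
    by (rule integrable_const_bound[where B = 1]) auto
  have i2: "integrable P (\<lambda>z. (1 - 2 * of_bool (f (fst z))) * of_bool (snd z) :: real)"
    by (rule integrable_const_bound[where B = 1]) auto
  have i3: "integrable P (\<lambda>z. (1 - 2 * of_bool (f (fst z))) * \<eta> (fst z) :: real)"
    by (rule integrable_const_bound[where B = 1]) (use eb in \<open>auto simp: PF(2)\<close>)
  have "risk P f = (\<integral>z. of_bool (snd z \<noteq> f (fst z)) \<partial>P)"
  proof -
    have "risk P f = (\<integral>z. indicator {z \<in> space P. snd z \<noteq> f (fst z)} z \<partial>P)"
      by (simp add: risk_def)
    also have "\<dots> = (\<integral>z. of_bool (snd z \<noteq> f (fst z)) \<partial>P)"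
      by (intro Bochner_Integration.integral_cong) (auto simp: indicator_def)
    finally show ?thesis .
  qed
  also have "\<dots> = (\<integral>z. of_bool (f (fst z)) + (1 - 2 * of_bool (f (fst z))) * of_bool (snd z) \<partial>P)"
    by (intro Bochner_Integration.integral_cong) auto
  also have "\<dots> = (\<integral>z. of_bool (f (fst z)) \<partial>P) + (\<integral>z. (1 - 2 * of_bool (f (fst z))) * of_bool (snd z) \<partial>P)"
    by (rule Bochner_Integration.integral_add[OF i1 i2])
  also have "(\<integral>z. (1 - 2 * of_bool (f (fst z))) * of_bool (snd z) \<partial>P) =
      (\<integral>z. (1 - 2 * of_bool (f (fst z))) * \<eta> (fst z) \<partial>P)"
    by (rule regression_version_integral[OF P eta, where B = 1]) auto
  also have "(\<integral>z. of_bool (f (fst z)) \<partial>P) + \<dots> =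
      (\<integral>z. of_bool (f (fst z)) + (1 - 2 * of_bool (f (fst z))) * \<eta> (fst z) \<partial>P)"
    by (rule Bochner_Integration.integral_add[OF i1 i3, symmetric])
  also have "\<dots> = (\<integral>z. \<eta> (fst z) + (1 - 2 * \<eta> (fst z)) * of_bool (f (fst z)) \<partial>P)"
    by (intro Bochner_Integration.integral_cong) (auto simp: algebra_simps)
  finally show ?thesis .
qed

text \<open>
  The Bayes classifier is built from an arbitrary version of the regression function; any other
  version gives the same risk, because the two agree almost everywhere.
\<close>

lemma risk_bayes_classifier:
  fixes P :: "((real ^ 'd) \<times> bool) measure"
  assumes P: "labelled_law P" and eta: "regression_version P \<eta>"
  shows "risk P (bayes_classifier P) = risk P (\<lambda>x. \<eta> x \<ge> 1 / 2)"
proof -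
  note PF = labelled_law_facts[OF P]
  note [measurable] = PF(3,5)
  define \<eta>' where "\<eta>' = (SOME \<eta>. regression_version P \<eta>)"
  have eta': "regression_version P \<eta>'"
    unfolding \<eta>'_def by (rule someI[of "regression_version P", OF eta])
  have [measurable]: "\<eta> \<in> borel_measurable cube_borel" "\<eta>' \<in> borel_measurable cube_borel"
    using eta eta' by (auto simp: regression_version_def)
  have b: "bayes_classifier P = (\<lambda>x. \<eta>' x \<ge> 1 / 2)"
    by (simp add: fun_eq_iff bayes_classifier_def \<eta>'_def)
  have ae: "AE z in P. \<eta> (fst z) = \<eta>' (fst z)"
    using eta eta' by (auto simp: regression_version_def)
  show ?thesis
    unfolding b
    apply (subst risk_eq[OF P eta], measurable)
    apply (subst risk_eq[OF P eta'], measurable)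
    apply (rule integral_cong_AE)
    subgoal by measurable
    subgoal by measurable
    subgoal using ae by auto
    done
qed

text \<open>
  Where a classifier deviates from the sign of \<open>\<eta> - 1 / 2\<close> it loses \<open>\<bar>2 * \<eta> - 1\<bar>\<close>. This reduces the excess
  risk to the probability of a deviation at each single location.
\<close>

lemma risk_minus_bayes_risk:
  fixes P :: "((real ^ 'd) \<times> bool) measure"
  assumes P: "labelled_law P" and eta: "regression_version P \<eta>"
    and f[measurable]: "f \<in> measurable cube_borel (count_space UNIV)"
  shows "risk P f - risk P (bayes_classifier P) =
    (\<integral>z. 2 * \<bar>\<eta> (fst z) - 1 / 2\<bar> * of_bool (f (fst z) \<noteq> (\<eta> (fst z) \<ge> 1 / 2)) \<partial>P)"
proof -
  note PF = labelled_law_facts[OF P]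
  note [measurable] = PF(3,5)
  have [measurable]: "\<eta> \<in> borel_measurable cube_borel"
    and eb: "\<And>x. x \<in> unit_cube \<Longrightarrow> 0 \<le> \<eta> x \<and> \<eta> x \<le> 1"
    using eta by (auto simp: regression_version_def)
  interpret prob_space P by (rule PF)
  have i: "integrable P (\<lambda>z. \<eta> (fst z) + (1 - 2 * \<eta> (fst z)) * of_bool (g (fst z)))"
    if [measurable]: "g \<in> measurable cube_borel (count_space UNIV)" for g
    by (rule integrable_const_bound[where B = 1]) (use eb in \<open>auto simp: PF(2)\<close>)
  show ?thesis
    unfolding risk_bayes_classifier[OF P eta] risk_eq[OF P eta f]
    apply (subst risk_eq[OF P eta])
     apply measurable
    apply (subst Bochner_Integration.integral_diff[symmetric, OF i i])
      apply measurable
    apply (intro Bochner_Integration.integral_cong)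
     apply (auto simp: algebra_simps)
    done
qed

lemma prob_space_data_law:
  assumes "\<And>j. j \<le> m \<Longrightarrow> labelled_law (P j)"
  shows "prob_space (data_law m n P)"
  unfolding data_law_def
  by (intro prob_space_PiM) (use labelled_law_facts(1)[OF assms] in auto)

lemma measurable_observation:
  assumes "j \<le> m" "i \<in> {1..n j}"
  shows "(\<lambda>D. D (j, i)) \<in> measurable (data_law m n P) (P j)"
proof -
  have "(\<lambda>D. D (j, i)) \<in> measurable (data_law m n P) ((\<lambda>(j, i). P j) (j, i))"
    unfolding data_law_def by (rule measurable_component_singleton) (use assms in auto)
  then show ?thesis by simp
qed

text \<open>
  The expectation over data and noise is exchanged with the one over the location, so that it remains
  to bound the probability of a wrong decision at a fixed location.
\<close>

lemma excess_risk_eq: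
  fixes P :: "nat \<Rightarrow> ((real ^ 'd) \<times> bool) measure"
  assumes P: "\<And>j. j \<le> m \<Longrightarrow> labelled_law (P j)" and eta: "regression_version (P 0) \<eta>"
    and N: "prob_space (N :: 'w measure)"
    and f: "(\<lambda>((D, \<omega>), x). f D \<omega> x)
      \<in> measurable ((data_law m n P \<Otimes>\<^sub>M N) \<Otimes>\<^sub>M cube_borel) (count_space UNIV)"
  shows "ennreal (excess_risk m n N f P) =
    (\<integral>\<^sup>+z. ennreal (2 * \<bar>\<eta> (fst z) - 1 / 2\<bar> * measure (data_law m n P \<Otimes>\<^sub>M N)
      {q \<in> space (data_law m n P \<Otimes>\<^sub>M N). f (fst q) (snd q) (fst z) \<noteq> (\<eta> (fst z) \<ge> 1 / 2)}) \<partial>P 0)"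
proof -
  define Q where "Q = data_law m n P \<Otimes>\<^sub>M N"
  have P0: "labelled_law (P 0)" using P by simp
  note PF = labelled_law_facts[OF P0]
  note [measurable] = PF(3,5)
  have em[measurable]: "\<eta> \<in> borel_measurable cube_borel"
    and eb: "\<And>x. x \<in> unit_cube \<Longrightarrow> 0 \<le> \<eta> x \<and> \<eta> x \<le> 1"
    using eta by (auto simp: regression_version_def)
  interpret D: prob_space "data_law m n P"
    by (rule prob_space_data_law) (rule P)
  interpret N: prob_space N by fact
  interpret DN: pair_prob_space "data_law m n P" N ..
  interpret Q: prob_space Q unfolding Q_def by (rule DN.prob_space_axioms)
  interpret P: prob_space "P 0" by (rule PF)
  interpret QP: pair_prob_space Q "P 0" ..
  have f1: "(\<lambda>p. f (fst (fst p)) (snd (fst p)) (snd p)) \<in> measurable (Q \<Otimes>\<^sub>M cube_borel) (count_space UNIV)"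
  proof -
    have "(\<lambda>((D, \<omega>), x). f D \<omega> x) = (\<lambda>p. f (fst (fst p)) (snd (fst p)) (snd p))"
      by (simp add: fun_eq_iff)
    then show ?thesis using f by (simp add: Q_def)
  qed
  have f2[measurable]: "(\<lambda>p. f (fst (fst p)) (snd (fst p)) (fst (snd p))) \<in> measurable (Q \<Otimes>\<^sub>M P 0) (count_space UNIV)"
  proof -
    have "(\<lambda>p. (fst p, fst (snd p))) \<in> measurable (Q \<Otimes>\<^sub>M P 0) (Q \<Otimes>\<^sub>M cube_borel)" by measurable
    from measurable_compose[OF this f1] show ?thesis by simp
  qed
  define u where "u q z = 2 * \<bar>\<eta> (fst z) - 1 / 2\<bar> * of_bool (f (fst q) (snd q) (fst z) \<noteq> (\<eta> (fst z) \<ge> 1 / 2))"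
    for q :: "(nat \<times> nat \<Rightarrow> (real ^ 'd) \<times> bool) \<times> 'w" and z :: "(real ^ 'd) \<times> bool"
  have u[measurable]: "(\<lambda>(q, z). u q z) \<in> borel_measurable (Q \<Otimes>\<^sub>M P 0)"
    unfolding u_def split_beta by measurable
  have u01: "0 \<le> u q z" "z \<in> space (P 0) \<Longrightarrow> u q z \<le> 1" for q z
    using eb[of "fst z"] by (auto simp: u_def PF(2) abs_if)
  have fq: "f (fst q) (snd q) \<in> measurable cube_borel (count_space UNIV)" if "q \<in> space Q" for q
    using measurable_compose[OF measurable_Pair1'[OF that, of cube_borel] f1] by simp
  have rq: "risk (P 0) (f (fst q) (snd q)) = risk (P 0) (bayes_classifier (P 0)) + (\<integral>z. u q z \<partial>P 0)"
    if "q \<in> space Q" for q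
    using risk_minus_bayes_risk[OF P0 eta fq[OF that]] by (simp add: u_def)
  have iu: "integrable (P 0) (u q)" if q: "q \<in> space Q" for q
  proof (rule P.integrable_const_bound[where B = 1])
    show "u q \<in> borel_measurable (P 0)"
      using measurable_compose[OF measurable_Pair1'[OF q, of "P 0"] u] by simp
  qed (use u01 in auto)
  have I01: "0 \<le> (\<integral>z. u q z \<partial>P 0)" "q \<in> space Q \<Longrightarrow> (\<integral>z. u q z \<partial>P 0) \<le> 1" for q
    using integral_mono[OF iu, of q "\<lambda>_. 1"] u01 by (auto simp: P.prob_space)
  have iI: "integrable Q (\<lambda>q. \<integral>z. u q z \<partial>P 0)"
    by (rule Q.integrable_const_bound[where B = 1]) (use I01 u in auto)
  have "excess_risk m n N f P = (\<integral>q. risk (P 0) (f (fst q) (snd q)) \<partial>Q) - risk (P 0) (bayes_classifier (P 0))"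
    by (simp add: excess_risk_def Q_def case_prod_beta')
  also have "(\<integral>q. risk (P 0) (f (fst q) (snd q)) \<partial>Q) =
      (\<integral>q. risk (P 0) (bayes_classifier (P 0)) + (\<integral>z. u q z \<partial>P 0) \<partial>Q)"
    by (rule Bochner_Integration.integral_cong) (auto simp: rq)
  also have "\<dots> = risk (P 0) (bayes_classifier (P 0)) + (\<integral>q. (\<integral>z. u q z \<partial>P 0) \<partial>Q)"
    using iI by (simp add: Q.prob_space)
  finally have "ennreal (excess_risk m n N f P) = ennreal (\<integral>q. (\<integral>z. u q z \<partial>P 0) \<partial>Q)" by simp
  also have "\<dots> = (\<integral>\<^sup>+q. ennreal (\<integral>z. u q z \<partial>P 0) \<partial>Q)"
    using iI I01 by (intro nn_integral_eq_integral[symmetric]) auto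
  also have "\<dots> = (\<integral>\<^sup>+q. (\<integral>\<^sup>+z. ennreal (u q z) \<partial>P 0) \<partial>Q)"
    using iu u01 by (intro nn_integral_cong nn_integral_eq_integral[symmetric]) auto
  also have "\<dots> = (\<integral>\<^sup>+z. (\<integral>\<^sup>+q. ennreal (u q z) \<partial>Q) \<partial>P 0)"
    by (rule QP.Fubini'[symmetric]) measurable
  also have "\<dots> = (\<integral>\<^sup>+z. ennreal (2 * \<bar>\<eta> (fst z) - 1 / 2\<bar> * measure Q
      {q \<in> space Q. f (fst q) (snd q) (fst z) \<noteq> (\<eta> (fst z) \<ge> 1 / 2)}) \<partial>P 0)"
  proof (rule nn_integral_cong)
    fix z assume z: "z \<in> space (P 0)"
    let ?E = "{q \<in> space Q. f (fst q) (snd q) (fst z) \<noteq> (\<eta> (fst z) \<ge> 1 / 2)}"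
    have [measurable]: "(\<lambda>q. f (fst q) (snd q) (fst z)) \<in> measurable Q (count_space UNIV)"
      using measurable_compose[OF measurable_Pair2'[OF z, of Q] f2] by simp
    have E: "?E \<in> sets Q" by measurable
    have "(\<integral>\<^sup>+q. ennreal (u q z) \<partial>Q) = (\<integral>\<^sup>+q. ennreal (2 * \<bar>\<eta> (fst z) - 1 / 2\<bar>) * indicator ?E q \<partial>Q)"
      by (intro nn_integral_cong) (auto simp: u_def indicator_def)
    also have "\<dots> = ennreal (2 * \<bar>\<eta> (fst z) - 1 / 2\<bar>) * emeasure Q ?E"
      by (rule nn_integral_cmult_indicator[OF E])
    finally show "(\<integral>\<^sup>+q. ennreal (u q z) \<partial>Q) = ennreal (2 * \<bar>\<eta> (fst z) - 1 / 2\<bar> * measure Q ?E)"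
      by (simp add: Q.emeasure_eq_measure ennreal_mult)
  qed
  finally show ?thesis unfolding Q_def .
qed

lemma excess_risk_le_1:
  assumes P: "\<And>j. j \<le> m \<Longrightarrow> labelled_law (P j)" and N: "prob_space N"
  shows "excess_risk m n N f P \<le> 1"
proof -
  interpret D: prob_space "data_law m n P"
    by (rule prob_space_data_law) (rule P)
  interpret N: prob_space N by fact
  interpret DN: pair_prob_space "data_law m n P" N ..
  interpret P0: prob_space "P 0" using labelled_law_facts(1)[OF P] by simp
  have r: "0 \<le> risk (P 0) g" "risk (P 0) g \<le> 1" for g
    by (auto simp: risk_def)
  \<comment> \<open>A function that is not integrable has integral 0, so the bound holds in either case.\<close>
  have "(\<integral>(D, \<omega>). risk (P 0) (f D \<omega>) \<partial>(data_law m n P \<Otimes>\<^sub>M N)) \<le> 1"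
  proof (cases "integrable (data_law m n P \<Otimes>\<^sub>M N) (\<lambda>(D, \<omega>). risk (P 0) (f D \<omega>))")
    case True
    then show ?thesis
      using integral_mono[OF True, of "\<lambda>_. 1"] r(2) by (auto simp: split_beta DN.prob_space)
  qed (simp add: not_integrable_integral_eq)
  then show ?thesis using r(1)[of "bayes_classifier (P 0)"] by (simp add: excess_risk_def)
qed


section \<open>Moments of the kernel weights\<close>

lemma smoothing_kernel_facts:
  fixes K :: "real ^ 'd \<Rightarrow> real"
  assumes "smoothing_kernel L\<^sub>K c\<^sub>K b\<^sub>K K"
  shows "0 \<le> K t" "K t \<le> c\<^sub>K" "t \<notin> cbox (- 1) 1 \<Longrightarrow> K t = 0" "K \<in> borel_measurable borel"
    "norm t \<le> 1 / 2 \<Longrightarrow> b\<^sub>K \<le> K t" "b\<^sub>K \<le> c\<^sub>K"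
proof -
  note k = assms[unfolded smoothing_kernel_def]
  show "0 \<le> K t" "K t \<le> c\<^sub>K" "t \<notin> cbox (- 1) 1 \<Longrightarrow> K t = 0" "norm t \<le> 1 / 2 \<Longrightarrow> b\<^sub>K \<le> K t"
    using k by blast+
  show "K \<in> borel_measurable borel"
    using k by (intro borel_measurable_continuous_onI lipschitz_on_continuous_on[of "L\<^sub>K"]) blast
  have "b\<^sub>K \<le> K 0" using k by simp
  then show "b\<^sub>K \<le> c\<^sub>K" using k order_trans by blast
qed

lemma nn_integral_covariate:
  fixes P :: "((real ^ 'd) \<times> bool) measure"
  assumes "fst \<in> borel_measurable P"
    and "covariate_law P = density lborel (\<lambda>x. ennreal (g x))" "g \<in> borel_measurable borel"
    and "\<phi> \<in> borel_measurable borel"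
  shows "(\<integral>\<^sup>+z. \<phi> (fst z) \<partial>P) = (\<integral>\<^sup>+x. ennreal (g x) * \<phi> x \<partial>lborel)"
proof -
  note [measurable] = assms(1,3,4)
  have "(\<integral>\<^sup>+z. \<phi> (fst z) \<partial>P) = (\<integral>\<^sup>+x. \<phi> x \<partial>covariate_law P)"
    unfolding covariate_law_def by (simp add: nn_integral_distr)
  then show ?thesis unfolding assms(2) by (simp add: nn_integral_density)
qed

lemma emeasure_fst_mem:
  assumes [measurable]: "fst \<in> borel_measurable P" "B \<in> sets borel"
  shows "emeasure P {z \<in> space P. fst z \<in> B} = (\<integral>\<^sup>+z. indicator B (fst z) \<partial>P)"
proof -
  have "(\<integral>\<^sup>+z. indicator B (fst z) \<partial>P) = (\<integral>\<^sup>+z. indicator {z \<in> space P. fst z \<in> B} z \<partial>P)"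
    by (intro nn_integral_cong) (auto simp: indicator_def)
  then show ?thesis by simp
qed

lemma AE_covariate_mem:
  fixes P :: "((real ^ 'd) \<times> bool) measure"
  assumes f: "fst \<in> borel_measurable P"
    and d: "covariate_law P = density lborel (\<lambda>x. ennreal (g x))" "g \<in> borel_measurable borel"
    and A: "A \<in> sets borel" "\<And>x. x \<notin> A \<Longrightarrow> g x = 0"
  shows "AE z in P. fst z \<in> A"
proof -
  note [measurable] = assms(1,3,4)
  have "(\<integral>\<^sup>+z. indicator (- A) (fst z) \<partial>P) = (\<integral>\<^sup>+x. ennreal (g x) * indicator (- A) x \<partial>lborel)"
    by (rule nn_integral_covariate[OF f d]) measurable
  also have "\<dots> = (\<integral>\<^sup>+x. 0 \<partial>(lborel :: (real ^ 'd) measure))"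
    by (intro nn_integral_cong) (auto simp: A(2) indicator_def)
  finally have "(\<integral>\<^sup>+z. indicator (- A) (fst z) \<partial>P) = 0" by simp
  moreover have "(\<lambda>z. indicator (- A) (fst z)) \<in> borel_measurable P" by measurable
  ultimately have "AE z in P. indicator (- A) (fst z) = (0 :: ennreal)"
    by (simp add: nn_integral_0_iff_AE)
  then show ?thesis by (auto simp: indicator_def split: if_splits)
qed

lemma measure_covariate_cbox_le:
  fixes P :: "((real ^ 'd) \<times> bool) measure"
  assumes P: "prob_space P" and f: "fst \<in> borel_measurable P"
    and d: "covariate_law P = density lborel (\<lambda>x. ennreal (g x))" "g \<in> borel_measurable borel"
    and g: "\<And>y. g y \<le> g\<^sub>m\<^sub>a\<^sub>x" "0 \<le> g\<^sub>m\<^sub>a\<^sub>x" and h: "0 < h"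
  shows "measure P {z \<in> space P. (fst z - x) /\<^sub>R h \<in> cbox (- 1) 1} \<le> g\<^sub>m\<^sub>a\<^sub>x * (2 * h) ^ CARD('d)"
proof -
  interpret prob_space P by fact
  note [measurable] = f d(2)
  let ?B = "cbox (\<chi> i. x $ i - h) (\<chi> i. x $ i + h)"
  have B: "(y - x) /\<^sub>R h \<in> cbox (- 1) 1 \<longleftrightarrow> y \<in> ?B" for y
    using h by (auto simp: mem_box_cart divide_simps algebra_simps)
  have m: "measure lborel ?B = (2 * h) ^ CARD('d)"
    using h by (subst content_cbox_cart) (auto simp: interval_ne_empty_cart prod_constant)
  have "emeasure P {z \<in> space P. (fst z - x) /\<^sub>R h \<in> cbox (- 1) 1} =
      (\<integral>\<^sup>+z. indicator ?B (fst z) \<partial>P)"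
    unfolding B by (rule emeasure_fst_mem) measurable
  also have "\<dots> = (\<integral>\<^sup>+y. ennreal (g y) * indicator ?B y \<partial>lborel)"
    by (rule nn_integral_covariate[OF f d]) measurable
  also have "\<dots> \<le> (\<integral>\<^sup>+y. ennreal g\<^sub>m\<^sub>a\<^sub>x * indicator ?B y \<partial>lborel)"
    by (intro nn_integral_mono mult_right_mono ennreal_leI g) auto
  also have "\<dots> = ennreal (g\<^sub>m\<^sub>a\<^sub>x * (2 * h) ^ CARD('d))"
    using g(2) h by (simp add: nn_integral_cmult ennreal_mult emeasure_eq_measure2 m
        emeasure_eq_ennreal_measure[of lborel ?B])
  finally show ?thesis
    using g(2) h by (simp add: emeasure_eq_measure)
qed

text \<open>
  The kernel is at least \<open>b\<^sub>K\<close> on the ball of radius \<open>h / 2\<close> around \<open>x\<close>, and by the regularity of the support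
  a fixed fraction of that ball carries density at least \<open>g\<^sub>m\<^sub>i\<^sub>n\<close>.
\<close>

lemma integral_kernel_ge:
  fixes P :: "((real ^ 'd) \<times> bool) measure" and K :: "real ^ 'd \<Rightarrow> real"
  assumes P: "prob_space P" and f: "fst \<in> borel_measurable P"
    and d: "covariate_law P = density lborel (\<lambda>x. ennreal (g x))" "g \<in> borel_measurable borel"
    and A: "regular_set c\<^sub>\<mu> r\<^sub>\<mu> A" "A \<in> sets borel" "x \<in> A"
    and g: "\<And>y. y \<in> A \<Longrightarrow> g\<^sub>m\<^sub>i\<^sub>n \<le> g y" "0 \<le> g\<^sub>m\<^sub>i\<^sub>n" and h: "0 < h" "h \<le> 2 * r\<^sub>\<mu>"
    and K: "smoothing_kernel L\<^sub>K c\<^sub>K b\<^sub>K K" and b: "0 \<le> b\<^sub>K"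
  shows "b\<^sub>K * g\<^sub>m\<^sub>i\<^sub>n * c\<^sub>\<mu> * unit_ball_vol (real CARD('d)) / 2 ^ CARD('d) * h ^ CARD('d)
    \<le> (\<integral>z. K ((fst z - x) /\<^sub>R h) \<partial>P)"
proof -
  interpret prob_space P by fact
  note KF = smoothing_kernel_facts[OF K]
  note [measurable] = f d(2) A(2) KF(4)
  let ?B = "A \<inter> ball x (h / 2)"
  have [measurable]: "?B \<in> sets borel" by simp
  have fin: "emeasure lborel ?B < \<infinity>"
    by (rule le_less_trans[OF emeasure_mono[of _ "ball x (h / 2)"] emeasure_lborel_ball_finite]) auto
  have "c\<^sub>\<mu> * (unit_ball_vol (real CARD('d)) / 2 ^ CARD('d) * h ^ CARD('d)) =
      c\<^sub>\<mu> * measure lborel (ball x (h / 2))"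
    using h(1) by (simp add: content_ball power_divide)
  also have "\<dots> \<le> measure lborel ?B"
    using A(1,3) h unfolding regular_set_def by simp
  finally have vol: "c\<^sub>\<mu> * (unit_ball_vol (real CARD('d)) / 2 ^ CARD('d) * h ^ CARD('d)) \<le> measure lborel ?B" .
  have "ennreal (g\<^sub>m\<^sub>i\<^sub>n * measure lborel ?B) = (\<integral>\<^sup>+y. ennreal g\<^sub>m\<^sub>i\<^sub>n * indicator ?B y \<partial>lborel)"
    using g(2) fin by (subst nn_integral_cmult_indicator)
      (auto simp: ennreal_mult emeasure_eq_ennreal_measure less_top[symmetric])
  also have "\<dots> \<le> (\<integral>\<^sup>+y. ennreal (g y) * indicator ?B y \<partial>lborel)"
    by (intro nn_integral_mono) (auto simp: indicator_def intro!: ennreal_leI g)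
  also have "\<dots> = (\<integral>\<^sup>+z. indicator ?B (fst z) \<partial>P)"
    by (rule nn_integral_covariate[OF f d, symmetric]) simp
  also have "\<dots> = emeasure P {z \<in> space P. fst z \<in> ?B}"
    by (rule emeasure_fst_mem[symmetric]) measurable
  finally have mass: "g\<^sub>m\<^sub>i\<^sub>n * measure lborel ?B \<le> prob {z \<in> space P. fst z \<in> ?B}"
    using g(2) by (simp add: emeasure_eq_measure)
  have "b\<^sub>K * (g\<^sub>m\<^sub>i\<^sub>n * (c\<^sub>\<mu> * (unit_ball_vol (real CARD('d)) / 2 ^ CARD('d) * h ^ CARD('d))))
      \<le> b\<^sub>K * prob {z \<in> space P. fst z \<in> ?B}"
    using mult_left_mono[OF vol g(2)] mass by (intro mult_left_mono b) linarith
  also have "\<dots> = (\<integral>z. b\<^sub>K * indicator {z \<in> space P. fst z \<in> ?B} z \<partial>P)"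
    by simp
  also have "\<dots> \<le> (\<integral>z. K ((fst z - x) /\<^sub>R h) \<partial>P)"
  proof (rule integral_mono)
    show "integrable P (\<lambda>z. b\<^sub>K * indicator {z \<in> space P. fst z \<in> ?B} z :: real)"
      by (rule integrable_const_bound[where B = b\<^sub>K]) (use b in \<open>auto simp: indicator_def\<close>)
    show "integrable P (\<lambda>z. K ((fst z - x) /\<^sub>R h))"
      by (rule integrable_const_bound[where B = c\<^sub>K]) (use KF(1,2) in auto)
    show "b\<^sub>K * indicator {z \<in> space P. fst z \<in> ?B} z \<le> K ((fst z - x) /\<^sub>R h)" for z
    proof (cases "fst z \<in> ball x (h / 2)")
      case True
      then have "norm ((fst z - x) /\<^sub>R h) \<le> 1 / 2"
        using h by (simp add: dist_norm norm_minus_commute divide_simps)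
      then show ?thesis using KF(5)[of "(fst z - x) /\<^sub>R h"] KF(1)[of "(fst z - x) /\<^sub>R h"]
        by (auto simp: indicator_def)
    qed (auto simp: KF(1))
  qed
  finally show ?thesis by (simp add: ac_simps)
qed

text \<open>
  The contribution of one observation to the local statistic at \<open>x\<close>, before normalisation.
\<close>

definition centred_label :: "(real ^ 'd \<Rightarrow> real) \<Rightarrow> real \<Rightarrow> real ^ 'd \<Rightarrow> (real ^ 'd) \<times> bool \<Rightarrow> real" where
  "centred_label K h x z = (of_bool (snd z) - 1 / 2) * K ((fst z - x) /\<^sub>R h)"

lemma centred_label_measurable:
  fixes P :: "((real ^ 'd) \<times> bool) measure"
  assumes "labelled_law P" "smoothing_kernel L\<^sub>K c\<^sub>K b\<^sub>K K"
  shows "centred_label K h x \<in> borel_measurable P"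
proof -
  note [measurable] = labelled_law_facts(4,5)[OF assms(1)] smoothing_kernel_facts(4)[OF assms(2)]
  show ?thesis unfolding centred_label_def by measurable
qed

lemma centred_label_bound:
  assumes "smoothing_kernel L\<^sub>K c\<^sub>K b\<^sub>K K"
  shows "\<bar>centred_label K h x z\<bar> \<le> c\<^sub>K / 2"
  using smoothing_kernel_facts(1,2)[OF assms, of "(fst z - x) /\<^sub>R h"]
  by (auto simp: centred_label_def)

text \<open>
  Since the kernel is nonnegative, a lower bound on the signed margin near \<open>x\<close> is inherited by the mean.
  The bound is pointwise on the kernel window, the form in which it is available for target and sources alike.
\<close>

lemma centred_label_signal:
  fixes P :: "((real ^ 'd) \<times> bool) measure" and K :: "real ^ 'd \<Rightarrow> real"
  assumes P: "labelled_law P" and eta: "regression_version P \<eta>"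
    and K: "smoothing_kernel L\<^sub>K c\<^sub>K b\<^sub>K K"
    and q: "\<And>y. y \<in> unit_cube \<Longrightarrow> (y - x) /\<^sub>R h \<in> cbox (- 1) 1 \<Longrightarrow> q \<le> \<sigma> * (\<eta> y - 1 / 2)"
  shows "q * (\<integral>z. K ((fst z - x) /\<^sub>R h) \<partial>P) \<le> \<sigma> * (\<integral>z. centred_label K h x z \<partial>P)"
proof -
  note PF = labelled_law_facts[OF P]
  note KF = smoothing_kernel_facts[OF K]
  note [measurable] = PF(3,4,5) KF(4)
  have [measurable]: "\<eta> \<in> borel_measurable cube_borel"
    and eb: "\<And>x. x \<in> unit_cube \<Longrightarrow> 0 \<le> \<eta> x \<and> \<eta> x \<le> 1"
    using eta by (auto simp: regression_version_def)
  interpret prob_space P by (rule PF)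
  let ?K = "\<lambda>y. K ((y - x) /\<^sub>R h)"
  have Km: "?K \<in> borel_measurable cube_borel"
    by (rule measurable_restrict_space1) measurable
  have iK: "integrable P (\<lambda>z. ?K (fst z))"
    by (rule integrable_const_bound[where B = c\<^sub>K]) (use KF(1,2) in auto)
  have bnd: "\<bar>?K y * c\<bar> \<le> c\<^sub>K" if "\<bar>c\<bar> \<le> 1" for y and c :: real
  proof -
    have "\<bar>?K y * c\<bar> = ?K y * \<bar>c\<bar>" using KF(1) by (simp add: abs_mult)
    also have "\<dots> \<le> ?K y * 1" using that KF(1) by (intro mult_left_mono) auto
    finally show ?thesis using KF(2)[of "(y - x) /\<^sub>R h"] by simp
  qed
  have iKs: "integrable P (\<lambda>z. ?K (fst z) * of_bool (snd z))"
    by (rule integrable_const_bound[where B = c\<^sub>K]) (use bnd in auto)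
  have iKe: "integrable P (\<lambda>z. ?K (fst z) * \<eta> (fst z))"
    by (rule integrable_const_bound[where B = c\<^sub>K])
      (use bnd eb in \<open>auto simp: PF(2) intro!: AE_I2\<close>)
  have "(\<integral>z. centred_label K h x z \<partial>P) = (\<integral>z. ?K (fst z) * of_bool (snd z) - 1 / 2 * ?K (fst z) \<partial>P)"
    by (intro Bochner_Integration.integral_cong) (auto simp: centred_label_def algebra_simps)
  also have "\<dots> = (\<integral>z. ?K (fst z) * \<eta> (fst z) \<partial>P) - 1 / 2 * (\<integral>z. ?K (fst z) \<partial>P)"
    using iKs iK regression_version_integral[OF P eta Km, of c\<^sub>K] KF(1,2) by simp
  also have "\<dots> = (\<integral>z. ?K (fst z) * (\<eta> (fst z) - 1 / 2) \<partial>P)"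
    using iKe iK by (simp add: right_diff_distrib)
  finally have c: "(\<integral>z. centred_label K h x z \<partial>P) = (\<integral>z. ?K (fst z) * (\<eta> (fst z) - 1 / 2) \<partial>P)" .
  have i: "integrable P (\<lambda>z. ?K (fst z) * (\<eta> (fst z) - 1 / 2))"
    using iKe iK by (simp add: right_diff_distrib)
  have "q * (\<integral>z. ?K (fst z) \<partial>P) = (\<integral>z. q * ?K (fst z) \<partial>P)" by simp
  also have "\<dots> \<le> (\<integral>z. \<sigma> * (?K (fst z) * (\<eta> (fst z) - 1 / 2)) \<partial>P)"
  proof (rule integral_mono)
    fix z assume "z \<in> space P"
    then have z: "fst z \<in> unit_cube" by (auto simp: PF(2))
    show "q * ?K (fst z) \<le> \<sigma> * (?K (fst z) * (\<eta> (fst z) - 1 / 2))"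
    proof (cases "(fst z - x) /\<^sub>R h \<in> cbox (- 1) 1")
      case True
      from mult_right_mono[OF q[OF z True] KF(1)] show ?thesis by (simp add: mult_ac)
    next
      case False
      then show ?thesis by (simp add: KF(3))
    qed
  qed (use iK i in auto)
  also have "\<dots> = \<sigma> * (\<integral>z. centred_label K h x z \<partial>P)" by (simp add: c)
  finally show ?thesis .
qed

lemma centred_label_second_moment_le:
  fixes P :: "((real ^ 'd) \<times> bool) measure" and K :: "real ^ 'd \<Rightarrow> real"
  assumes P: "labelled_law P" and K: "smoothing_kernel L\<^sub>K c\<^sub>K b\<^sub>K K"
    and d: "covariate_law P = density lborel (\<lambda>x. ennreal (g x))" "g \<in> borel_measurable borel"
    and g: "\<And>y. g y \<le> g\<^sub>m\<^sub>a\<^sub>x" "0 \<le> g\<^sub>m\<^sub>a\<^sub>x" and h: "0 < h"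
  shows "(\<integral>z. (centred_label K h x z)\<^sup>2 \<partial>P) \<le> (c\<^sub>K\<^sup>2 / 4 * g\<^sub>m\<^sub>a\<^sub>x * 2 ^ CARD('d)) * h ^ CARD('d)"
proof -
  note PF = labelled_law_facts[OF P]
  note KF = smoothing_kernel_facts[OF K]
  note [measurable] = PF(4) centred_label_measurable[OF P K, of h x]
  interpret prob_space P by (rule PF)
  let ?B = "{z \<in> space P. (fst z - x) /\<^sub>R h \<in> cbox (- 1) 1}"
  have B[measurable]: "?B \<in> sets P" by measurable
  have sq: "(centred_label K h x z)\<^sup>2 \<le> c\<^sub>K\<^sup>2 / 4" for z
    using power_mono[OF centred_label_bound[OF K, of h x z], of 2] by (simp add: power_divide)
  have "(\<integral>z. (centred_label K h x z)\<^sup>2 \<partial>P) \<le> (\<integral>z. c\<^sub>K\<^sup>2 / 4 * indicator ?B z \<partial>P)"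
  proof (rule integral_mono)
    show "integrable P (\<lambda>z. (centred_label K h x z)\<^sup>2)"
      by (rule integrable_const_bound[where B = "c\<^sub>K\<^sup>2 / 4"]) (use sq in auto)
    show "integrable P (\<lambda>z. c\<^sub>K\<^sup>2 / 4 * indicator ?B z :: real)"
      by (rule integrable_const_bound[where B = "c\<^sub>K\<^sup>2 / 4"]) (auto simp: indicator_def)
    show "(centred_label K h x z)\<^sup>2 \<le> c\<^sub>K\<^sup>2 / 4 * indicator ?B z" if "z \<in> space P" for z
      using sq[of z] KF(3)[of "(fst z - x) /\<^sub>R h"] that
      by (auto simp: indicator_def centred_label_def)
  qed
  also have "\<dots> = c\<^sub>K\<^sup>2 / 4 * prob ?B" by simp
  also have "\<dots> \<le> c\<^sub>K\<^sup>2 / 4 * (g\<^sub>m\<^sub>a\<^sub>x * (2 * h) ^ CARD('d))"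
    by (intro mult_left_mono measure_covariate_cbox_le[OF PF(1,4) d g h]) auto
  finally show ?thesis by (simp add: power_mult_distrib mult_ac)
qed


section \<open>Exponential moments of the score\<close>

text \<open>
  The observations are independent, so the exponential moment of their weighted sum factorises.
\<close>

lemma data_exp_moment_le:
  fixes P :: "nat \<Rightarrow> ((real ^ 'd) \<times> bool) measure" and \<sigma> :: real
  assumes P: "\<And>j. j \<le> m \<Longrightarrow> labelled_law (P j)" and K: "smoothing_kernel L\<^sub>K c\<^sub>K b\<^sub>K K"
    and \<sigma>: "\<bar>\<sigma>\<bar> = 1"
    and t: "\<And>j. j \<le> m \<Longrightarrow> 0 \<le> t j" "\<And>j. j \<le> m \<Longrightarrow> t j * (c\<^sub>K / 2) \<le> 1"
    and S: "\<And>j. j \<le> m \<Longrightarrow> S j \<le> \<sigma> * (\<integral>z. centred_label K h x z \<partial>P j)"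
    and V: "\<And>j. j \<le> m \<Longrightarrow> (\<integral>z. (centred_label K h x z)\<^sup>2 \<partial>P j) \<le> V j"
  shows "(\<integral>\<^sup>+D. ennreal (exp (- (\<sigma> * (\<Sum>j\<le>m. \<Sum>i=1..n j. t j * centred_label K h x (D (j, i))))))
      \<partial>data_law m n P) \<le> ennreal (exp (\<Sum>j\<le>m. real (n j) * (- (t j * S j) + (t j)\<^sup>2 * V j)))"
proof -
  let ?W = "centred_label K h x"
  let ?I = "SIGMA j:{..m}. {1..n j}"
  \<comment> \<open>A product of measures needs a sigma-finite factor at every index, also at those that do not occur.\<close>
  define Q where "Q = (\<lambda>(j, i :: nat). P (min j m))"
  have dl: "data_law m n P = PiM ?I Q"
    unfolding data_law_def Q_def by (intro PiM_cong) auto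
  have lQ: "labelled_law (Q p)" for p
    unfolding Q_def using P by (auto split: prod.splits)
  interpret product_sigma_finite Q
    by (rule product_sigma_finite.intro) (rule prob_space_imp_sigma_finite[OF labelled_law_facts(1)[OF lQ]])
  have one: "(\<integral>\<^sup>+z. ennreal (exp (- (t j * (\<sigma> * ?W z)))) \<partial>P j)
      \<le> ennreal (exp (- (t j * S j) + (t j)\<^sup>2 * V j))" if j: "j \<le> m" for j
  proof -
    interpret Pj: prob_space "P j" by (rule labelled_law_facts(1)[OF P[OF j]])
    note [measurable] = centred_label_measurable[OF P[OF j] K, of h x]
    have s2: "\<sigma>\<^sup>2 = 1" using \<sigma> by (metis power2_abs power_one)
    show ?thesis
    proof (rule Pj.exp_moment_le)
      show "\<bar>\<sigma> * ?W z\<bar> \<le> c\<^sub>K / 2" for z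
        unfolding abs_mult \<sigma> mult_1 by (rule centred_label_bound[OF K])
      show "S j \<le> (\<integral>z. \<sigma> * ?W z \<partial>P j)" using S[OF j] by simp
      show "(\<integral>z. (\<sigma> * ?W z)\<^sup>2 \<partial>P j) \<le> V j" using V[OF j] by (simp add: power_mult_distrib s2)
    qed (use t[OF j] in auto)
  qed
  have "(\<integral>\<^sup>+D. ennreal (exp (- (\<sigma> * (\<Sum>j\<le>m. \<Sum>i=1..n j. t j * ?W (D (j, i)))))) \<partial>data_law m n P)
      = (\<integral>\<^sup>+D. (\<Prod>p\<in>?I. ennreal (exp (- (t (fst p) * (\<sigma> * ?W (D p)))))) \<partial>PiM ?I Q)"
  proof -
    have "- (\<sigma> * (\<Sum>j\<le>m. \<Sum>i=1..n j. t j * ?W (D (j, i)))) = (\<Sum>p\<in>?I. - (t (fst p) * (\<sigma> * ?W (D p))))" for D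
      by (subst sum.Sigma) (simp_all add: sum_negf sum_distrib_left split_beta mult.left_commute)
    then show ?thesis
      unfolding dl by (simp add: prod_ennreal exp_sum[symmetric])
  qed
  also have "\<dots> = (\<Prod>p\<in>?I. \<integral>\<^sup>+z. ennreal (exp (- (t (fst p) * (\<sigma> * ?W z)))) \<partial>Q p)"
  proof (rule product_nn_integral_prod)
    fix p
    note [measurable] = centred_label_measurable[OF lQ[of p] K, of h x]
    show "(\<lambda>z. ennreal (exp (- (t (fst p) * (\<sigma> * ?W z))))) \<in> borel_measurable (Q p)"
      by measurable
  qed simp
  also have "\<dots> \<le> (\<Prod>p\<in>?I. ennreal (exp (- (t (fst p) * S (fst p)) + (t (fst p))\<^sup>2 * V (fst p))))"
    using one by (intro prod_mono_ennreal) (auto simp: Q_def)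
  also have "\<dots> = ennreal (exp (\<Sum>p\<in>?I. - (t (fst p) * S (fst p)) + (t (fst p))\<^sup>2 * V (fst p)))"
    by (simp add: prod_ennreal exp_sum)
  also have "(\<Sum>p\<in>?I. - (t (fst p) * S (fst p)) + (t (fst p))\<^sup>2 * V (fst p)) =
      (\<Sum>j\<le>m. \<Sum>i=1..n j. - (t j * S j) + (t j)\<^sup>2 * V j)"
    by (subst sum.Sigma) (auto simp: split_beta)
  also have "\<dots> = (\<Sum>j\<le>m. real (n j) * (- (t j * S j) + (t j)\<^sup>2 * V j))"
    by simp
  finally show ?thesis .
qed

text \<open>
  The processes of different servers are independent, and each contributes a centred normal variable
  of variance \<open>K 0\<close>.
\<close>

lemma noise_exp_moment:
  fixes K :: "real ^ 'd \<Rightarrow> real"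
  assumes N: "noise_processes m K h N \<xi>" and x: "x \<in> unit_cube"
  shows "(\<integral>\<^sup>+\<omega>. ennreal (exp (\<Sum>j\<le>m. b j * \<xi> j \<omega> x)) \<partial>N) = ennreal (exp (\<Sum>j\<le>m. (b j)\<^sup>2 * K 0 / 2))"
proof -
  interpret prob_space N using N by (simp add: noise_processes_def)
  have iv: "indep_vars (\<lambda>_. PiM unit_cube (\<lambda>_. borel)) (\<lambda>j \<omega>. restrict (\<xi> j \<omega>) unit_cube) {..m}"
    using N by (simp add: noise_processes_def)
  have [measurable]: "(\<lambda>f. f x) \<in> borel_measurable (PiM unit_cube (\<lambda>_. borel :: real measure))"
    by (rule measurable_component_singleton[OF x])
  have "indep_vars (\<lambda>_. borel) (\<lambda>j \<omega>. ennreal (exp (b j * (restrict (\<xi> j \<omega>) unit_cube) x))) {..m}"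
    by (rule indep_vars_compose2[OF iv, of "\<lambda>j f. ennreal (exp (b j * f x))" "\<lambda>_. borel"]) measurable
  then have iv': "indep_vars (\<lambda>_. borel) (\<lambda>j \<omega>. ennreal (exp (b j * \<xi> j \<omega> x))) {..m}"
    using x by simp
  have "(\<integral>\<^sup>+\<omega>. ennreal (exp (\<Sum>j\<le>m. b j * \<xi> j \<omega> x)) \<partial>N) =
      (\<integral>\<^sup>+\<omega>. (\<Prod>j\<le>m. ennreal (exp (b j * \<xi> j \<omega> x))) \<partial>N)"
    by (simp add: prod_ennreal exp_sum)
  also have "\<dots> = (\<Prod>j\<le>m. \<integral>\<^sup>+\<omega>. ennreal (exp (b j * \<xi> j \<omega> x)) \<partial>N)"
    by (rule indep_vars_nn_integral[OF _ iv']) auto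
  also have "\<dots> = (\<Prod>j\<le>m. ennreal (exp ((b j)\<^sup>2 * K 0 / 2)))"
  proof (rule prod.cong)
    fix j assume "j \<in> {..m}"
    then have "centered_gaussian_process N unit_cube (\<lambda>s t. K ((s - t) /\<^sub>R h)) (\<xi> j)"
      using N by (simp add: noise_processes_def)
    from gaussian_process_exp_moment[OF this x, of "b j"]
    show "(\<integral>\<^sup>+\<omega>. ennreal (exp (b j * \<xi> j \<omega> x)) \<partial>N) = ennreal (exp ((b j)\<^sup>2 * K 0 / 2))" by simp
  qed simp
  also have "\<dots> = ennreal (exp (\<Sum>j\<le>m. (b j)\<^sup>2 * K 0 / 2))"
    by (simp add: prod_ennreal exp_sum)
  finally show ?thesis .
qed

lemma measurable_private_classifier:
  fixes P :: "nat \<Rightarrow> ((real ^ 'd) \<times> bool) measure" and K :: "real ^ 'd \<Rightarrow> real"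
  assumes P: "\<And>j. j \<le> m \<Longrightarrow> labelled_law (P j)" and K: "smoothing_kernel L\<^sub>K c\<^sub>K b\<^sub>K K"
    and N: "noise_processes m K h N \<xi>"
  shows "(\<lambda>((D, \<omega>), x). private_classifier m \<beta> \<gamma> c\<^sub>K K n \<epsilon> \<delta> h D (\<lambda>j. \<xi> j \<omega>) x)
    \<in> measurable ((data_law m n P \<Otimes>\<^sub>M N) \<Otimes>\<^sub>M cube_borel) (count_space UNIV)"
proof -
  let ?M = "(data_law m n P \<Otimes>\<^sub>M N) \<Otimes>\<^sub>M (cube_borel :: (real ^ 'd) measure)"
  note [measurable] = smoothing_kernel_facts(4)[OF K]
  have [measurable]: "snd \<in> measurable ?M borel"
    using measurable_snd[of "data_law m n P \<Otimes>\<^sub>M N" "cube_borel :: (real ^ 'd) measure"]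
      measurable_restrict_space2_iff by blast
  have xi: "(\<lambda>p. \<xi> j (snd (fst p)) (snd p)) \<in> borel_measurable ?M" if "j \<le> m" for j
  proof -
    have [measurable]: "(\<lambda>(\<omega>, x). \<xi> j \<omega> x) \<in> borel_measurable (N \<Otimes>\<^sub>M cube_borel)"
      using N that by (simp add: noise_processes_def)
    have "(\<lambda>p. (\<lambda>(\<omega>, x). \<xi> j \<omega> x) (snd (fst p), snd p)) \<in> borel_measurable ?M"
      by (rule measurable_compose[OF _ \<open>(\<lambda>(\<omega>, x). \<xi> j \<omega> x) \<in> _\<close>]) measurable
    then show ?thesis by simp
  qed
  have loc: "(\<lambda>p. local_statistic K n h j (fst (fst p)) (snd p)) \<in> borel_measurable ?M" if j: "j \<le> m" for j
  proof -
    have D: "(\<lambda>p. fst (fst p) (j, i)) \<in> measurable ?M (P j)" if "i \<in> {1..n j}" for i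
    proof -
      note [measurable] = measurable_observation[where P = P and n = n, OF j that]
      show ?thesis by measurable
    qed
    have "(\<lambda>p. (of_bool (snd (fst (fst p) (j, i))) - 1 / 2) * K ((fst (fst (fst p) (j, i)) - snd p) /\<^sub>R h))
        \<in> borel_measurable ?M" if i: "i \<in> {1..n j}" for i
    proof -
      note [measurable] = measurable_compose[OF D[OF i] labelled_law_facts(4)[OF P[OF j]]]
        measurable_compose[OF D[OF i] labelled_law_facts(5)[OF P[OF j]]]
      show ?thesis by measurable
    qed
    then show ?thesis unfolding local_statistic_def
      by (intro borel_measurable_times[OF borel_measurable_const] borel_measurable_sum)
  qed
  have "(\<lambda>p. \<Sum>j\<le>m. server_weight CARD('d) m \<beta> \<gamma> n \<epsilon> h j *
        (local_statistic K n h j (fst (fst p)) (snd p) +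
          noise_scale CARD('d) c\<^sub>K n \<epsilon> \<delta> h j * \<xi> j (snd (fst p)) (snd p))) \<in> borel_measurable ?M"
    by (intro borel_measurable_sum borel_measurable_times borel_measurable_add xi loc borel_measurable_const)
      auto
  then show ?thesis unfolding private_classifier_def split_beta by measurable
qed


section \<open>The rate function and its solutions\<close>

text \<open>
  Lets the target take part in sums over all servers, with exponent 1.
\<close>

definition full_exponent :: "(nat \<Rightarrow> real) \<Rightarrow> nat \<Rightarrow> real" where
  "full_exponent \<gamma> j = (if j = 0 then 1 else \<gamma> j)"

lemma rate_function_eq_sum:
  "rate_function d m \<beta> \<gamma> n \<epsilon> s =
    (\<Sum>j\<le>m. effective_size d (n j) (\<epsilon> j) s * s powr (2 * \<beta> * full_exponent \<gamma> j + real d))"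
proof -
  have "{..m} = insert 0 {1..m}" by auto
  then show ?thesis by (simp add: rate_function_def full_exponent_def)
qed

lemma effective_size_pos:
  assumes "1 \<le> n" "0 < \<epsilon>" "0 < s"
  shows "0 < effective_size d n \<epsilon> s"
  using assms by (simp add: effective_size_def)

lemma effective_size_mono:
  assumes "0 \<le> s" "s \<le> t"
  shows "effective_size d n \<epsilon> s \<le> effective_size d n \<epsilon> t"
proof -
  have "(real n)\<^sup>2 * \<epsilon>\<^sup>2 * s ^ d \<le> (real n)\<^sup>2 * \<epsilon>\<^sup>2 * t ^ d"
    using assms by (intro mult_left_mono power_mono) auto
  then show ?thesis unfolding effective_size_def by (rule min.mono[OF order_refl])
qed

abbreviation (input) least_exponent :: "nat \<Rightarrow> (nat \<Rightarrow> real) \<Rightarrow> real" where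
  "least_exponent m \<gamma> \<equiv> Min (insert 1 (\<gamma> ` {1..m}))"

lemma least_exponent_facts:
  assumes "\<forall>j\<in>{1..m}. 0 < \<gamma> j"
  shows "0 < least_exponent m \<gamma>" "\<And>j. j \<le> m \<Longrightarrow> least_exponent m \<gamma> \<le> full_exponent \<gamma> j"
  using assms by (auto simp: full_exponent_def)

text \<open>
  All summands of the rate function grow at least like a power with the smallest exponent \<open>p\<close>, so the
  solution for a larger level is at most \<open>\<Lambda> powr (1 / p)\<close> times the one for level 1.
\<close>

lemma solution_le:
  fixes h r \<Lambda> p :: real
  assumes rates: "rate_function d m \<beta> \<gamma> n \<epsilon> h \<le> \<Lambda>" "rate_function d m \<beta> \<gamma> n \<epsilon> r = 1"
    and "0 < h" "0 < r" and p: "0 < p" "\<And>j. j \<le> m \<Longrightarrow> p \<le> 2 * \<beta> * full_exponent \<gamma> j + real d"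
    and \<Lambda>: "1 \<le> \<Lambda>"
  shows "h \<le> r * \<Lambda> powr (1 / p)"
proof (rule ccontr)
  assume ng: "\<not> h \<le> r * \<Lambda> powr (1 / p)"
  \<comment> \<open>Enlarging \<open>r\<close> by a factor \<open>\<kappa> \<ge> 1\<close> multiplies each summand of the rate function by at least \<open>\<kappa> powr p\<close>.\<close>
  define \<kappa> where "\<kappa> = h / r"
  have lt: "\<Lambda> powr (1 / p) < \<kappa>" and h: "h = r * \<kappa>"
    using ng assms(4) by (auto simp: \<kappa>_def field_simps)
  have k1: "1 \<le> \<kappa>"
    using ge_one_powr_ge_zero[OF \<Lambda>, of "1 / p"] p lt by simp
  let ?e = "\<lambda>j s. effective_size d (n j) (\<epsilon> j) s * s powr (2 * \<beta> * full_exponent \<gamma> j + real d)"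
  have ef0: "0 \<le> effective_size d (n j) (\<epsilon> j) r" for j
    using assms(4) by (simp add: effective_size_def)
  have "\<Lambda> = (\<Lambda> powr (1 / p)) powr p" using \<Lambda> p by (simp add: powr_powr)
  also have "\<dots> < \<kappa> powr p" using lt p by (intro powr_less_mono2) auto
  also have "\<kappa> powr p = (\<Sum>j\<le>m. \<kappa> powr p * ?e j r)"
    using rates(2) unfolding rate_function_eq_sum by (simp add: sum_distrib_left[symmetric])
  also have "\<dots> \<le> (\<Sum>j\<le>m. ?e j h)"
  proof (rule sum_mono)
    fix j assume "j \<in> {..m}"
    then have j: "j \<le> m" by simp
    have "\<kappa> powr p * ?e j r = effective_size d (n j) (\<epsilon> j) r *
        (r powr (2 * \<beta> * full_exponent \<gamma> j + real d) * \<kappa> powr p)"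
      by simp
    also have "\<dots> \<le> effective_size d (n j) (\<epsilon> j) h *
        (r powr (2 * \<beta> * full_exponent \<gamma> j + real d) * \<kappa> powr (2 * \<beta> * full_exponent \<gamma> j + real d))"
    proof (rule mult_mono)
      show "effective_size d (n j) (\<epsilon> j) r \<le> effective_size d (n j) (\<epsilon> j) h"
        using mult_left_mono[OF k1, of r] assms(4) by (intro effective_size_mono) (auto simp: h)
      show "r powr (2 * \<beta> * full_exponent \<gamma> j + real d) * \<kappa> powr p \<le>
          r powr (2 * \<beta> * full_exponent \<gamma> j + real d) * \<kappa> powr (2 * \<beta> * full_exponent \<gamma> j + real d)"
        by (intro mult_left_mono powr_mono p(2)[OF j] k1) simp
      show "0 \<le> effective_size d (n j) (\<epsilon> j) h"
        using assms(3) by (simp add: effective_size_def)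
    qed simp
    also have "\<dots> = ?e j h" using assms(4) k1 by (simp add: h powr_mult)
    finally show "\<kappa> powr p * ?e j r \<le> ?e j h" .
  qed
  also have "\<dots> \<le> \<Lambda>" using rates(1) by (simp add: rate_function_eq_sum)
  finally show False by simp
qed

text \<open>
  The level \<open>ln (2 / \<delta>\<^sub>0)\<close> is comparable with \<open>ln (1 / \<delta>\<^sub>0)\<close> only if \<open>\<delta>\<^sub>0\<close> stays away from 1, which is
  where \<open>\<Delta>\<close> enters the constant.
\<close>

lemma bandwidth_powr_le:
  fixes h r q \<delta>\<^sub>0 \<Delta> :: real
  assumes rates: "rate_function d m \<beta> \<gamma> n \<epsilon> h = ln (2 / \<delta>\<^sub>0)" "rate_function d m \<beta> \<gamma> n \<epsilon> r = 1"
    and pos: "0 < h" "0 < r" "0 \<le> \<beta>" "0 < d" "0 \<le> q"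
    and \<gamma>: "\<And>j. j \<in> {1..m} \<Longrightarrow> 0 < \<gamma> j"
    and \<delta>: "0 < \<delta>\<^sub>0" "\<delta>\<^sub>0 \<le> \<Delta>" "\<Delta> < 1"
  shows "h powr q \<le> (1 + 1 / ln (1 / \<Delta>)) powr (q / (2 * \<beta> * least_exponent m \<gamma> + real d)) *
    (r powr q * ln (1 / \<delta>\<^sub>0) powr (q / (2 * \<beta> * least_exponent m \<gamma> + real d)))"
proof -
  define p where "p = 2 * \<beta> * least_exponent m \<gamma> + real d"
  define l where "l = ln (1 / \<delta>\<^sub>0)"
  define l' where "l' = ln (1 / \<Delta>)"
  have "\<forall>j\<in>{1..m}. 0 < \<gamma> j" using \<gamma> by blast
  note lf = least_exponent_facts[OF this]
  have p: "0 < p" unfolding p_def using pos lf(1) by (intro add_nonneg_pos mult_nonneg_nonneg) auto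
  have l': "0 < l'" unfolding l'_def using \<delta> by (intro ln_gt_zero) (auto simp: divide_simps)
  have ll: "l' \<le> l" unfolding l_def l'_def using \<delta> by (subst ln_le_cancel_iff) (auto simp: frac_le)
  have "ln (2 / \<delta>\<^sub>0) = ln 2 + l" unfolding l_def using \<delta> by (simp add: ln_div)
  then have "rate_function d m \<beta> \<gamma> n \<epsilon> h \<le> 1 + l" using rates(1) ln_2_less_1 by simp
  then have "h \<le> r * (1 + l) powr (1 / p)"
  proof (rule solution_le[OF _ rates(2) pos(1,2) p])
    show "p \<le> 2 * \<beta> * full_exponent \<gamma> j + real d" if "j \<le> m" for j
      unfolding p_def using mult_left_mono[OF lf(2)[OF that], of "2 * \<beta>"] pos by simp
    show "1 \<le> 1 + l" using l' ll by simp
  qed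
  then have "h powr q \<le> (r * (1 + l) powr (1 / p)) powr q"
    using pos by (intro powr_mono2) auto
  also have "\<dots> = r powr q * (1 + l) powr (q / p)"
    using pos l' ll by (simp add: powr_mult powr_powr)
  also have "\<dots> \<le> r powr q * ((1 + 1 / l') * l) powr (q / p)"
  proof (intro mult_left_mono powr_mono2)
    show "1 + l \<le> (1 + 1 / l') * l" using l' ll by (simp add: field_simps)
  qed (use l' ll p pos in auto)
  also have "\<dots> = (1 + 1 / l') powr (q / p) * (r powr q * l powr (q / p))"
    using l' ll by (simp add: powr_mult)
  finally show ?thesis unfolding p_def l_def l'_def .
qed


section \<open>Misclassification at a fixed location\<close>

lemma nn_integral_pair_mult:
  fixes F :: "'a \<Rightarrow> ennreal" and G :: "'b \<Rightarrow> ennreal"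
  assumes "sigma_finite_measure N"
    and [measurable]: "F \<in> borel_measurable M" "G \<in> borel_measurable N"
  shows "(\<integral>\<^sup>+q. F (fst q) * G (snd q) \<partial>(M \<Otimes>\<^sub>M N)) = (\<integral>\<^sup>+x. F x \<partial>M) * (\<integral>\<^sup>+y. G y \<partial>N)"
proof -
  interpret sigma_finite_measure N by fact
  show ?thesis
    by (subst nn_integral_fst[symmetric]) (simp_all add: nn_integral_cmult nn_integral_multc)
qed

text \<open>
  A Chernoff bound at one location, where \<open>\<sigma>\<close> is the sign that the score should have. Writing
  \<open>\<Lambda> = ln (2 / \<delta>\<^sub>m\<^sub>i\<^sub>n)\<close> for the value of the rate function at \<open>h\<close>, and measuring everything in units of
  \<open>\<Lambda> / h ^ d\<close>, the weighted signal is at least \<open>a\<close>, the standard deviation of the privacy noise is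
  bounded, and so is that of the sampling error because \<open>\<Lambda> \<ge> ln 2\<close>. One fixed Chernoff parameter
  therefore gives a bound that is exponential in \<open>a\<close> and free of the sample sizes and the privacy
  parameters.
\<close>

lemma private_misclassification_le:
  fixes P :: "nat \<Rightarrow> ((real ^ 'd) \<times> bool) measure" and K :: "real ^ 'd \<Rightarrow> real"
  assumes P: "\<And>j. j \<le> m \<Longrightarrow> labelled_law (P j)" and K: "smoothing_kernel L\<^sub>K c\<^sub>K b\<^sub>K K"
    and N: "noise_processes m K h N \<xi>" and x: "x \<in> unit_cube"
    and pos: "0 < c\<^sub>K" "0 \<le> \<beta>" "0 < h" "h \<le> 1" "\<And>j. j \<in> {1..m} \<Longrightarrow> 0 < \<gamma> j"
    and srv: "\<And>j. j \<le> m \<Longrightarrow> 1 \<le> n j" "\<And>j. j \<le> m \<Longrightarrow> 0 < \<epsilon> j"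
      "\<And>j. j \<le> m \<Longrightarrow> 0 < \<delta> j" "\<And>j. j \<le> m \<Longrightarrow> \<delta> j < 1"
    and rate: "rate_function CARD('d) m \<beta> \<gamma> n \<epsilon> h = ln (2 / Min (\<delta> ` {..m}))"
    and \<sigma>: "\<bar>\<sigma>\<bar> = 1"
    and signal: "\<And>j. j \<le> m \<Longrightarrow> a * h ^ CARD('d) * h powr (\<beta> * full_exponent \<gamma> j)
        \<le> \<sigma> * (\<integral>z. centred_label K h x z \<partial>P j)"
    and var: "\<And>j. j \<le> m \<Longrightarrow> (\<integral>z. (centred_label K h x z)\<^sup>2 \<partial>P j) \<le> V * h ^ CARD('d)"
    and V: "0 \<le> V"
  shows "emeasure (data_law m n P \<Otimes>\<^sub>M N) {q \<in> space (data_law m n P \<Otimes>\<^sub>M N).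
      private_classifier m \<beta> \<gamma> c\<^sub>K K n \<epsilon> \<delta> h (fst q) (\<lambda>j. \<xi> j (snd q)) x \<noteq> (\<sigma> > 0)}
    \<le> ennreal (exp (1 + V / (c\<^sub>K\<^sup>2 * ln 2) - a / c\<^sub>K))"
    (is "emeasure ?Q ?E \<le> _")
proof -
  define d where "d = CARD('d)"
  define \<Lambda> where "\<Lambda> = ln (2 / Min (\<delta> ` {..m}))"
  define g where "g = full_exponent \<gamma>"
  define ef where "ef j = effective_size d (n j) (\<epsilon> j) h" for j
  \<comment> \<open>The summands \<open>e j\<close> of the rate function add up to \<open>\<Lambda>\<close>. Every first or second moment below is
    compared with a multiple of one of them, and this is what makes the weights \<open>v j\<close> the right ones.\<close>
  define v where "v j = raw_weight d \<beta> \<gamma> n \<epsilon> h j" for j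
  define e where "e j = ef j * h powr (2 * \<beta> * g j + real d)" for j
  define sc where "sc = noise_scale d c\<^sub>K n \<epsilon> \<delta> h"
  \<comment> \<open>The Chernoff parameter. The Gaussian exponent is of order \<open>s\<^sup>2 * \<Lambda>\<^sup>2 / h ^ (2 * d)\<close>, hence the factor
    \<open>1 / \<Lambda>\<close>; the factor \<open>1 / c\<^sub>K\<close> keeps all exponents \<open>t j * centred_label\<close> inside \<open>[- 1, 1]\<close>.\<close>
  define s where "s = h ^ d / (c\<^sub>K * \<Lambda>)"
  define t where "t j = v j / (c\<^sub>K * \<Lambda> * real (n j))" for j
  define b where "b j = s * v j * sc j" for j
  have dmin: "0 < Min (\<delta> ` {..m})" "Min (\<delta> ` {..m}) < 1"
    using srv(3,4) by (auto simp: Min_less_iff intro!: bexI[of _ 0])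
  have Lge: "ln 2 \<le> \<Lambda>"
    unfolding \<Lambda>_def using dmin by (subst ln_le_cancel_iff) (auto simp: divide_simps)
  then have Lpos: "0 < \<Lambda>" using ln_gt_zero[of "2::real"] by linarith
  have sume: "(\<Sum>j\<le>m. e j) = \<Lambda>"
    using rate unfolding rate_function_eq_sum \<Lambda>_def e_def ef_def g_def d_def by simp
  have gpos: "0 \<le> g j" if "j \<le> m" for j
    using pos(5)[of j] that by (cases "j = 0") (auto simp: g_def full_exponent_def)
  have v_eq: "v j = ef j * h powr (\<beta> * g j)" for j
    by (simp add: v_def raw_weight_def ef_def g_def full_exponent_def mult.commute)
  have ef_pos: "0 < ef j" if "j \<le> m" for j
    unfolding ef_def by (rule effective_size_pos) (use srv that pos in auto)
  have v_pos: "0 < v j" if "j \<le> m" for j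
    using ef_pos[OF that] pos by (simp add: v_eq)
  have ef_le: "ef j \<le> real (n j)" "ef j \<le> (real (n j))\<^sup>2 * (\<epsilon> j)\<^sup>2 * h ^ d" for j
    by (simp_all add: ef_def effective_size_def)
  have hd: "h powr real d = h ^ d" using pos by (simp add: powr_realpow)
  have e_eq: "e j = v j * h powr (\<beta> * g j) * h ^ d" for j
  proof -
    have "2 * \<beta> * g j + real d = \<beta> * g j + \<beta> * g j + real d" by simp
    then show ?thesis unfolding e_def v_eq by (simp only: powr_add hd mult.assoc)
  qed
  have v_sq: "(v j)\<^sup>2 * h ^ d = e j * ef j" for j
    unfolding e_eq unfolding v_eq by (simp add: power2_eq_square)
  \<comment> \<open>Since \<open>h \<le> 1\<close>, the coefficient of a single observation is at most \<open>1 / (c\<^sub>K * \<Lambda>)\<close>.\<close>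
  have v_le: "v j \<le> real (n j)" if "j \<le> m" for j
  proof -
    have "h powr (\<beta> * g j) \<le> 1"
      using pos gpos[OF that] by (intro powr_le1) auto
    then have "v j \<le> ef j" using ef_pos[OF that] by (simp add: v_eq mult_left_le)
    with ef_le(1)[of j] show ?thesis by linarith
  qed
  have npos: "0 < real (n j)" if "j \<le> m" for j using srv(1)[OF that] by simp
  have e_pos: "0 < e j" if "j \<le> m" for j using ef_pos[OF that] pos by (simp add: e_def)
  have W_pos: "0 < (\<Sum>j\<le>m. v j)" by (rule sum_pos) (auto simp: v_pos)
  \<comment> \<open>The normalisation of the weights is a positive factor, so the sign of the score may be read off
    from the unnormalised sum, in which every observation enters with its own coefficient \<open>t j\<close>.\<close>
  let ?score = "\<lambda>D \<omega>. \<Sum>j\<le>m. server_weight d m \<beta> \<gamma> n \<epsilon> h j *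
        (local_statistic K n h j D x + sc j * \<xi> j \<omega> x)"
  let ?F = "\<lambda>D. \<sigma> * (\<Sum>j\<le>m. \<Sum>i=1..n j. t j * centred_label K h x (D (j, i)))"
  let ?G = "\<lambda>\<omega>. \<Sum>j\<le>m. - (\<sigma> * b j) * \<xi> j \<omega> x"
  have score: "\<sigma> * (s * (\<Sum>j\<le>m. v j) * ?score D \<omega>) = ?F D - ?G \<omega>" for D \<omega>
  proof -
    have "?score D \<omega> = (\<Sum>j\<le>m. v j * (local_statistic K n h j D x + sc j * \<xi> j \<omega> x)) / (\<Sum>j\<le>m. v j)"
      by (simp add: server_weight_def v_def[symmetric] sum_divide_distrib)
    then have "s * (\<Sum>j\<le>m. v j) * ?score D \<omega> =
        s * (\<Sum>j\<le>m. v j * (local_statistic K n h j D x + sc j * \<xi> j \<omega> x))"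
      using W_pos by simp
    also have "\<dots> = (\<Sum>j\<le>m. s * v j * (local_statistic K n h j D x + sc j * \<xi> j \<omega> x))"
      by (simp only: sum_distrib_left mult.assoc)
    also have "\<dots> = (\<Sum>j\<le>m. (\<Sum>i=1..n j. t j * centred_label K h x (D (j, i))) + b j * \<xi> j \<omega> x)"
    proof (rule sum.cong)
      fix j assume "j \<in> {..m}"
      then have tj: "s * v j / (real (n j) * h ^ d) = t j"
        using npos[of j] pos(3) by (simp add: s_def t_def)
      have "s * v j * local_statistic K n h j D x =
          (s * v j / (real (n j) * h ^ d)) * (\<Sum>i=1..n j. centred_label K h x (D (j, i)))"
        by (simp add: local_statistic_def centred_label_def d_def[symmetric])
      then have "s * v j * local_statistic K n h j D x = t j * (\<Sum>i=1..n j. centred_label K h x (D (j, i)))"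
        unfolding tj .
      then show "s * v j * (local_statistic K n h j D x + sc j * \<xi> j \<omega> x) =
          (\<Sum>i=1..n j. t j * centred_label K h x (D (j, i))) + b j * \<xi> j \<omega> x"
        by (simp add: b_def distrib_left sum_distrib_left)
    qed simp
    finally show ?thesis
      by (simp add: sum.distrib distrib_left sum_distrib_left sum_negf ac_simps)
  qed
  have dataF: "(\<integral>\<^sup>+D. ennreal (exp (- ?F D)) \<partial>data_law m n P)
      \<le> ennreal (exp (V / (c\<^sub>K\<^sup>2 * ln 2) - a / c\<^sub>K))"
  proof -
    have "(\<integral>\<^sup>+D. ennreal (exp (- ?F D)) \<partial>data_law m n P) \<le> ennreal (exp (\<Sum>j\<le>m. real (n j) *
        (- (t j * (a * h ^ d * h powr (\<beta> * g j))) + (t j)\<^sup>2 * (V * h ^ d))))"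
    proof (rule data_exp_moment_le[OF P K \<sigma>])
      fix j assume j: "j \<le> m"
      show "0 \<le> t j" unfolding t_def using v_pos[OF j] pos Lpos by simp
      have "t j * c\<^sub>K = v j / real (n j) / \<Lambda>" using pos(1) by (simp add: t_def)
      also have "\<dots> \<le> 1 / \<Lambda>"
        using v_le[OF j] npos[OF j] Lpos by (intro divide_right_mono) auto
      also have "\<dots> \<le> 2"
        using Lge ln2_ge_two_thirds Lpos by (simp add: divide_simps)
      finally show "t j * (c\<^sub>K / 2) \<le> 1" by simp
    qed (use signal var in \<open>auto simp: g_def d_def\<close>)
    also have "\<dots> \<le> ennreal (exp (V / (c\<^sub>K\<^sup>2 * ln 2) - a / c\<^sub>K))"
    proof (intro ennreal_leI, subst exp_le_cancel_iff)
      have "(\<Sum>j\<le>m. real (n j) * (- (t j * (a * h ^ d * h powr (\<beta> * g j))) + (t j)\<^sup>2 * (V * h ^ d)))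
          \<le> (\<Sum>j\<le>m. e j * (V / (c\<^sub>K\<^sup>2 * \<Lambda>\<^sup>2) - a / (c\<^sub>K * \<Lambda>)))"
      proof (rule sum_mono)
        fix j assume "j \<in> {..m}"
        then have j: "j \<le> m" by simp
        have "real (n j) * (t j * (a * h ^ d * h powr (\<beta> * g j))) = e j * (a / (c\<^sub>K * \<Lambda>))"
          using npos[OF j] by (simp add: t_def e_eq)
        moreover have "real (n j) * ((t j)\<^sup>2 * (V * h ^ d)) = (v j)\<^sup>2 * h ^ d / real (n j) * (V / (c\<^sub>K\<^sup>2 * \<Lambda>\<^sup>2))"
          using npos[OF j] by (simp add: t_def power2_eq_square mult_ac)
        moreover have "(v j)\<^sup>2 * h ^ d / real (n j) \<le> e j"
          unfolding v_sq using ef_le(1)[of j] e_pos[OF j] npos[OF j] by (simp add: divide_simps)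
        then have "(v j)\<^sup>2 * h ^ d / real (n j) * (V / (c\<^sub>K\<^sup>2 * \<Lambda>\<^sup>2)) \<le> e j * (V / (c\<^sub>K\<^sup>2 * \<Lambda>\<^sup>2))"
          using V by (intro mult_right_mono) auto
        ultimately show "real (n j) * (- (t j * (a * h ^ d * h powr (\<beta> * g j))) + (t j)\<^sup>2 * (V * h ^ d))
            \<le> e j * (V / (c\<^sub>K\<^sup>2 * \<Lambda>\<^sup>2) - a / (c\<^sub>K * \<Lambda>))"
          unfolding distrib_left right_diff_distrib mult_minus_right by linarith
      qed
      also have "\<dots> = \<Lambda> * (V / (c\<^sub>K\<^sup>2 * \<Lambda>\<^sup>2) - a / (c\<^sub>K * \<Lambda>))"
        by (simp only: sum_distrib_right[symmetric] sume)
      also have "\<dots> = V / (c\<^sub>K\<^sup>2 * \<Lambda>) - a / c\<^sub>K"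
        using Lpos by (simp add: right_diff_distrib power2_eq_square)
      also have "\<dots> \<le> V / (c\<^sub>K\<^sup>2 * ln 2) - a / c\<^sub>K"
        using V Lge pos(1) by (intro diff_right_mono divide_left_mono mult_left_mono mult_pos_pos) (auto simp: Lpos)
      finally show "(\<Sum>j\<le>m. real (n j) * (- (t j * (a * h ^ d * h powr (\<beta> * g j))) + (t j)\<^sup>2 * (V * h ^ d)))
          \<le> V / (c\<^sub>K\<^sup>2 * ln 2) - a / c\<^sub>K" .
    qed
    finally show ?thesis .
  qed
  have noiseG: "(\<integral>\<^sup>+\<omega>. ennreal (exp (?G \<omega>)) \<partial>N) \<le> ennreal (exp 1)"
  proof -
    have "(\<integral>\<^sup>+\<omega>. ennreal (exp (?G \<omega>)) \<partial>N) = ennreal (exp (\<Sum>j\<le>m. (- (\<sigma> * b j))\<^sup>2 * K 0 / 2))"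
      by (rule noise_exp_moment[OF N x])
    also have "\<dots> \<le> ennreal (exp 1)"
    proof (intro ennreal_leI, subst exp_le_cancel_iff)
      have "(\<Sum>j\<le>m. (- (\<sigma> * b j))\<^sup>2 * K 0 / 2) \<le> (\<Sum>j\<le>m. e j / \<Lambda>)"
      proof (rule sum_mono)
        fix j assume "j \<in> {..m}"
        then have j: "j \<le> m" by simp
        have "Min (\<delta> ` {..m}) \<le> \<delta> j" using j by simp
        then have ld: "ln (2 / \<delta> j) \<le> \<Lambda>"
          unfolding \<Lambda>_def using dmin srv(3)[OF j] by (subst ln_le_cancel_iff) (auto simp: frac_le)
        have ld0: "0 \<le> ln (2 / \<delta> j)"
          using srv(3,4)[OF j] by (intro ln_ge_zero) (auto simp: divide_simps)
        let ?q = "(real (n j))\<^sup>2 * (\<epsilon> j)\<^sup>2"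
        have q: "0 < ?q" using npos[OF j] srv(2)[OF j] by simp
        have s2: "\<sigma>\<^sup>2 = 1" using \<sigma> by (metis power2_abs power_one)
        have "(- (\<sigma> * b j))\<^sup>2 = (s * v j)\<^sup>2 * (sc j)\<^sup>2"
          by (simp add: b_def power_mult_distrib s2)
        also have "(sc j)\<^sup>2 = 2 * c\<^sub>K * ln (2 / \<delta> j) / (?q * (h ^ d)\<^sup>2)"
          using ld0 pos(1) by (simp add: sc_def noise_scale_def power_divide power_mult_distrib)
        also have "(s * v j)\<^sup>2 * \<dots> = (v j)\<^sup>2 * 2 * ln (2 / \<delta> j) / (c\<^sub>K * \<Lambda>\<^sup>2 * ?q)"
          using pos by (simp add: s_def power2_eq_square mult_ac)
        finally have "(- (\<sigma> * b j))\<^sup>2 * K 0 / 2 = (v j)\<^sup>2 / ?q * (ln (2 / \<delta> j) / \<Lambda>\<^sup>2) * (K 0 / c\<^sub>K)"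
          by (simp add: mult_ac)
        also have "\<dots> \<le> e j * (\<Lambda> / \<Lambda>\<^sup>2) * 1"
        proof (intro mult_mono)
          have "(v j)\<^sup>2 * h ^ d \<le> e j * (?q * h ^ d)"
            unfolding v_sq using ef_le(2)[of j] e_pos[OF j] by (intro mult_left_mono) auto
          then have "(v j)\<^sup>2 \<le> e j * ?q" using pos(3) by simp
          then show "(v j)\<^sup>2 / ?q \<le> e j" using q by (simp add: divide_simps)
          show "ln (2 / \<delta> j) / \<Lambda>\<^sup>2 \<le> \<Lambda> / \<Lambda>\<^sup>2" using ld by (intro divide_right_mono) auto
          show "K 0 / c\<^sub>K \<le> 1" using smoothing_kernel_facts(2)[OF K, of 0] pos(1) by simp
        qed (use ld0 Lpos e_pos[OF j] smoothing_kernel_facts(1)[OF K, of 0] pos(1) in auto)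
        also have "\<dots> = e j / \<Lambda>" using Lpos by (simp add: power2_eq_square)
        finally show "(- (\<sigma> * b j))\<^sup>2 * K 0 / 2 \<le> e j / \<Lambda>" .
      qed
      also have "\<dots> = 1" using Lpos by (simp add: sum_divide_distrib[symmetric] sume)
      finally show "(\<Sum>j\<le>m. (- (\<sigma> * b j))\<^sup>2 * K 0 / 2) \<le> 1" .
    qed
    finally show ?thesis .
  qed
  \<comment> \<open>A misclassification forces \<open>\<sigma>\<close> times the score to be nonpositive; data and noise then separate.\<close>
  have "emeasure ?Q ?E \<le> (\<integral>\<^sup>+q. indicator ?E q \<partial>?Q)"
    by (cases "?E \<in> sets ?Q") (auto simp: emeasure_notin_sets)
  also have "\<dots> \<le> (\<integral>\<^sup>+q. ennreal (exp (- ?F (fst q))) * ennreal (exp (?G (snd q))) \<partial>?Q)"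
  proof (rule nn_integral_mono)
    fix q
    show "indicator ?E q \<le> ennreal (exp (- ?F (fst q))) * ennreal (exp (?G (snd q)))"
    proof (cases "q \<in> ?E")
      case True
      then have "\<sigma> * ?score (fst q) (snd q) \<le> 0"
        using \<sigma> unfolding private_classifier_def d_def[symmetric] sc_def[symmetric]
        by (auto simp: abs_if mult_le_0_iff not_le split: if_splits intro: less_imp_le)
      moreover have "0 < s * (\<Sum>j\<le>m. v j)"
        using W_pos pos Lpos by (simp add: s_def)
      ultimately have "(s * (\<Sum>j\<le>m. v j)) * (\<sigma> * ?score (fst q) (snd q)) \<le> 0"
        by (simp add: mult_le_0_iff)
      then have "?F (fst q) - ?G (snd q) \<le> 0"
        unfolding score[symmetric] by (simp add: ac_simps)
      then have "1 \<le> exp (- ?F (fst q) + ?G (snd q))" unfolding one_le_exp_iff by linarith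
      then have "1 \<le> ennreal (exp (- ?F (fst q)) * exp (?G (snd q)))"
        unfolding exp_add by (simp only: ennreal_1[symmetric] ennreal_leI)
      then have "1 \<le> ennreal (exp (- ?F (fst q))) * ennreal (exp (?G (snd q)))"
        by (simp only: ennreal_mult exp_ge_zero)
      with True show ?thesis by (simp only: indicator_simps)
    qed simp
  qed
  also have "\<dots> = (\<integral>\<^sup>+D. ennreal (exp (- ?F D)) \<partial>data_law m n P) * (\<integral>\<^sup>+\<omega>. ennreal (exp (?G \<omega>)) \<partial>N)"
  proof -
    interpret N: prob_space N using N by (simp add: noise_processes_def)
    have xi: "(\<lambda>\<omega>. \<xi> j \<omega> x) \<in> borel_measurable N" if "j \<le> m" for j
      using N that x by (simp add: noise_processes_def centered_gaussian_process_def)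
    have G[measurable]: "?G \<in> borel_measurable N"
      by (intro borel_measurable_sum borel_measurable_times xi) auto
    have "(\<lambda>D. centred_label K h x (D (j, i))) \<in> borel_measurable (data_law m n P)"
      if "j \<le> m" "i \<in> {1..n j}" for j i
      by (rule measurable_compose[where g = "centred_label K h x",
            OF measurable_observation[where P = P and n = n, OF that] centred_label_measurable[OF P[OF that(1)] K]])
    then have F[measurable]: "?F \<in> borel_measurable (data_law m n P)"
      by (intro borel_measurable_sum borel_measurable_times borel_measurable_const) auto
    show ?thesis
      by (rule nn_integral_pair_mult) (use N.sigma_finite_measure_axioms F G in measurable)
  qed
  also have "\<dots> \<le> ennreal (exp (V / (c\<^sub>K\<^sup>2 * ln 2) - a / c\<^sub>K)) * ennreal (exp 1)"
    by (rule mult_mono[OF dataF noiseG]) auto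
  also have "\<dots> = ennreal (exp (1 + V / (c\<^sub>K\<^sup>2 * ln 2) - a / c\<^sub>K))"
    by (simp add: ennreal_mult[symmetric] exp_add[symmetric])
  finally show ?thesis .
qed

lemma norm_le_of_scaled_mem_cbox:
  fixes y x :: "real ^ 'd"
  assumes "(y - x) /\<^sub>R h \<in> cbox (- 1) 1" "0 < h"
  shows "norm (y - x) \<le> real CARD('d) * h"
proof -
  have "\<bar>(y - x) $ i\<bar> \<le> h" for i
    using assms by (auto simp: mem_box_cart abs_le_iff divide_simps dest!: spec[of _ i])
  then have "(\<Sum>i\<in>UNIV. \<bar>(y - x) $ i\<bar>) \<le> real CARD('d) * h"
    using sum_bounded_above[of UNIV "\<lambda>i. \<bar>(y - x) $ i\<bar>" h] by simp
  then show ?thesis using norm_le_l1_cart[of "y - x"] by linarith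
qed

text \<open>
  By smoothness \<open>\<eta>\<close> varies on the kernel window by at most half of the margin at its centre, the points of
  the window being at distance at most \<open>CARD('d) * h\<close> from there.
\<close>

lemma smooth_margin_locally:
  fixes \<eta> :: "real ^ 'd \<Rightarrow> real"
  assumes holder: "\<And>x x'. x \<in> unit_cube \<Longrightarrow> x' \<in> unit_cube \<Longrightarrow> \<bar>\<eta> x - \<eta> x'\<bar> \<le> L * norm (x - x') powr \<beta>"
    and x: "x \<in> unit_cube" and y: "y \<in> unit_cube" "(y - x) /\<^sub>R h \<in> cbox (- 1) 1"
    and pos: "0 < h" "0 \<le> L" "0 \<le> \<beta>"
    and far: "2 * L * real CARD('d) powr \<beta> * h powr \<beta> \<le> \<bar>\<eta> x - 1 / 2\<bar>"
    and \<sigma>: "\<sigma> = (if \<eta> x \<ge> 1 / 2 then 1 else - 1)"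
  shows "\<bar>\<eta> x - 1 / 2\<bar> / 2 \<le> \<sigma> * (\<eta> y - 1 / 2)"
proof -
  have "\<bar>\<eta> y - \<eta> x\<bar> \<le> L * norm (y - x) powr \<beta>" by (rule holder[OF y(1) x])
  also have "\<dots> \<le> L * (real CARD('d) * h) powr \<beta>"
    using norm_le_of_scaled_mem_cbox[OF y(2) pos(1)] pos by (intro mult_left_mono powr_mono2) auto
  also have "\<dots> = L * real CARD('d) powr \<beta> * h powr \<beta>"
    using pos by (simp add: powr_mult)
  also have "\<dots> \<le> \<bar>\<eta> x - 1 / 2\<bar> / 2" using far by simp
  finally show ?thesis using \<sigma> by (auto simp: abs_if split: if_splits)
qed

text \<open>
  The signal hypothesis of the Chernoff bound is met once the margin is a large multiple of
  \<open>h powr \<beta>\<close>. The target keeps sign and half of its margin on the kernel window; a source has the same sign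
  there and at least \<open>C j\<close> times the power \<open>\<gamma> j\<close> of the target margin. The resulting bound depends on
  the margin in units of \<open>h powr \<beta>\<close>, and its constants only on the class and on the kernel. The constant
  \<open>c\<close> is a lower bound for the kernel-weighted mass per volume \<open>h ^ d\<close>, times the least \<open>C j\<close>, over the \<open>c\<^sub>K\<close> of the
  Chernoff bound; the power of 2 comes from halving the margin.
\<close>

lemma misclassification_tail:
  fixes P :: "nat \<Rightarrow> ((real ^ 'd) \<times> bool) measure" and K :: "real ^ 'd \<Rightarrow> real"
    and \<gamma> C :: "nat \<Rightarrow> real" and m :: nat and b\<^sub>K c\<^sub>K g\<^sub>m\<^sub>i\<^sub>n c\<^sub>\<mu> :: real
  defines "c \<equiv> b\<^sub>K * g\<^sub>m\<^sub>i\<^sub>n * c\<^sub>\<mu> * unit_ball_vol (real CARD('d)) / 2 ^ CARD('d) *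
      Min (insert 1 (C ` {1..m})) / (c\<^sub>K * 2 powr least_exponent m \<gamma>)"
  assumes P: "\<And>j. j \<le> m \<Longrightarrow> labelled_law (P j)" and eta: "\<And>j. j \<le> m \<Longrightarrow> regression_version (P j) (\<eta> j)"
    and sources: "\<And>j y. j \<in> {1..m} \<Longrightarrow> y \<in> unit_cube \<Longrightarrow>
        sgn (\<eta> j y - 1 / 2) = sgn (\<eta> 0 y - 1 / 2) \<and> \<bar>\<eta> j y - 1 / 2\<bar> \<ge> C j * \<bar>\<eta> 0 y - 1 / 2\<bar> powr \<gamma> j"
    and holder: "\<And>y y'. y \<in> unit_cube \<Longrightarrow> y' \<in> unit_cube \<Longrightarrow> \<bar>\<eta> 0 y - \<eta> 0 y'\<bar> \<le> L * norm (y - y') powr \<beta>"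
    and A: "compact A" "A \<subseteq> unit_cube" "regular_set c\<^sub>\<mu> r\<^sub>\<mu> A" "x \<in> A"
    and dens: "\<And>j. j \<le> m \<Longrightarrow> \<exists>g \<in> borel_measurable borel.
        covariate_law (P j) = density lborel (\<lambda>x. ennreal (g x)) \<and>
        (\<forall>x\<in>A. g\<^sub>m\<^sub>i\<^sub>n \<le> g x \<and> g x \<le> g\<^sub>m\<^sub>a\<^sub>x) \<and> (\<forall>x. x \<notin> A \<longrightarrow> g x = 0)"
    and const: "0 < \<beta>" "0 < L" "\<And>j. j \<in> {1..m} \<Longrightarrow> 0 < \<gamma> j" "\<And>j. j \<in> {1..m} \<Longrightarrow> 0 < C j"
      "0 < g\<^sub>m\<^sub>i\<^sub>n" "g\<^sub>m\<^sub>i\<^sub>n < g\<^sub>m\<^sub>a\<^sub>x" "0 < c\<^sub>\<mu>" "0 < b\<^sub>K"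
    and K: "smoothing_kernel L\<^sub>K c\<^sub>K b\<^sub>K K" and N: "noise_processes m K h N \<xi>"
    and srv: "\<And>j. j \<le> m \<Longrightarrow> 1 \<le> n j" "\<And>j. j \<le> m \<Longrightarrow> 0 < \<epsilon> j"
      "\<And>j. j \<le> m \<Longrightarrow> 0 < \<delta> j" "\<And>j. j \<le> m \<Longrightarrow> \<delta> j < 1"
    and rate: "rate_function CARD('d) m \<beta> \<gamma> n \<epsilon> h = ln (2 / Min (\<delta> ` {..m}))"
    and h: "0 < h" "h \<le> 1" "h \<le> 2 * r\<^sub>\<mu>"
    and far: "(2 + 2 * L * real CARD('d) powr \<beta>) * h powr \<beta> \<le> \<bar>\<eta> 0 x - 1 / 2\<bar>"
  shows "measure (data_law m n P \<Otimes>\<^sub>M N) {q \<in> space (data_law m n P \<Otimes>\<^sub>M N).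
      private_classifier m \<beta> \<gamma> c\<^sub>K K n \<epsilon> \<delta> h (fst q) (\<lambda>j. \<xi> j (snd q)) x \<noteq> (\<eta> 0 x \<ge> 1 / 2)}
    \<le> exp (1 + g\<^sub>m\<^sub>a\<^sub>x * 2 ^ CARD('d) / (4 * ln 2)) *
      exp (- (c * (\<bar>\<eta> 0 x - 1 / 2\<bar> / h powr \<beta>) powr least_exponent m \<gamma>))"
proof -
  define \<zeta> where "\<zeta> = \<bar>\<eta> 0 x - 1 / 2\<bar>"
  define y where "y = \<zeta> / h powr \<beta>"
  define \<gamma>\<^sub>0 where "\<gamma>\<^sub>0 = least_exponent m \<gamma>"
  define C\<^sub>0 where "C\<^sub>0 = Min (insert 1 (C ` {1..m}))"
  define k where "k = b\<^sub>K * g\<^sub>m\<^sub>i\<^sub>n * c\<^sub>\<mu> * unit_ball_vol (real CARD('d)) / 2 ^ CARD('d)"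
  define \<sigma> :: real where "\<sigma> = (if \<eta> 0 x \<ge> 1 / 2 then 1 else - 1)"
  define V where "V = c\<^sub>K\<^sup>2 / 4 * g\<^sub>m\<^sub>a\<^sub>x * 2 ^ CARD('d)"
  \<comment> \<open>Since \<open>y / 2 \<ge> 1\<close>, the smallest exponent gives a lower bound common to all servers.\<close>
  define a where "a = k * C\<^sub>0 * (y / 2) powr \<gamma>\<^sub>0"
  have "\<forall>j\<in>{1..m}. 0 < \<gamma> j" using const(3) by blast
  note lf = least_exponent_facts[OF this, folded \<gamma>\<^sub>0_def]
  have x: "x \<in> unit_cube" using A by auto
  have cK: "0 < c\<^sub>K" using smoothing_kernel_facts(6)[OF K] const(8) by linarith
  have C0: "0 < C\<^sub>0" "C\<^sub>0 \<le> 1" "\<And>j. j \<in> {1..m} \<Longrightarrow> C\<^sub>0 \<le> C j"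
    using const(4) unfolding C\<^sub>0_def by (auto intro!: Min_le simp del: Min_insert)
  have hb: "0 < h powr \<beta>" using h by simp
  have k0: "0 \<le> k" unfolding k_def using const by simp
  have y2: "1 \<le> y / 2"
  proof -
    have "2 * h powr \<beta> \<le> (2 + 2 * L * real CARD('d) powr \<beta>) * h powr \<beta>"
      using const hb by (intro mult_right_mono) auto
    with far have "2 * h powr \<beta> \<le> \<zeta>" unfolding \<zeta>_def by linarith
    then show ?thesis using hb by (simp add: y_def field_simps)
  qed
  have z2: "\<zeta> / 2 = y / 2 * h powr \<beta>" using hb by (simp add: y_def)
  have zpos: "0 < \<zeta> / 2" unfolding z2 using y2 hb by (intro mult_pos_pos) linarith+
  have far': "2 * L * real CARD('d) powr \<beta> * h powr \<beta> \<le> \<bar>\<eta> 0 x - 1 / 2\<bar>"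
    using far hb unfolding distrib_right by linarith
  have near_target: "\<zeta> / 2 \<le> \<sigma> * (\<eta> 0 z - 1 / 2)"
    if "z \<in> unit_cube" "(z - x) /\<^sub>R h \<in> cbox (- 1) 1" for z
    unfolding \<zeta>_def
    by (rule smooth_margin_locally[OF holder x that h(1) _ _ far' \<sigma>_def]) (use const in auto)
  have sig: "a * h ^ CARD('d) * h powr (\<beta> * full_exponent \<gamma> j) \<le> \<sigma> * (\<integral>z. centred_label K h x z \<partial>P j)"
    if j: "j \<le> m" for j
  proof -
    note PF = labelled_law_facts[OF P[OF j]]
    obtain g where g: "g \<in> borel_measurable borel"
      "covariate_law (P j) = density lborel (\<lambda>x. ennreal (g x))" "\<And>x. x \<in> A \<Longrightarrow> g\<^sub>m\<^sub>i\<^sub>n \<le> g x"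
      using dens[OF j] by blast
    let ?q = "C\<^sub>0 * (\<zeta> / 2) powr full_exponent \<gamma> j"
    have near: "?q \<le> \<sigma> * (\<eta> j z - 1 / 2)"
      if z: "z \<in> unit_cube" "(z - x) /\<^sub>R h \<in> cbox (- 1) 1" for z
    proof (cases "j = 0")
      case True
      have "C\<^sub>0 * (\<zeta> / 2) \<le> 1 * (\<zeta> / 2)" by (rule mult_right_mono) (use C0 zpos in auto)
      then have le: "C\<^sub>0 * (\<zeta> / 2) \<le> \<sigma> * (\<eta> 0 z - 1 / 2)" using near_target[OF z] by linarith
      have e: "(\<zeta> / 2) powr full_exponent \<gamma> 0 = \<zeta> / 2"
        using zpos by (simp add: full_exponent_def)
      show ?thesis unfolding True e by (rule le)
    next
      case False
      then have j1: "j \<in> {1..m}" using j by simp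
      have "?q \<le> C j * \<bar>\<eta> 0 z - 1 / 2\<bar> powr \<gamma> j"
        using False C0(1) C0(3)[OF j1] near_target[OF z] zpos const(3)[OF j1]
        by (intro mult_mono)
          (auto simp: full_exponent_def \<sigma>_def split: if_splits intro!: powr_mono2)
      also have "\<dots> \<le> \<bar>\<eta> j z - 1 / 2\<bar>" using sources[OF j1 z(1)] by simp
      also have "\<dots> = \<sigma> * (\<eta> j z - 1 / 2)"
        using sources[OF j1 z(1)] near_target[OF z] zpos
        by (auto simp: \<sigma>_def abs_if sgn_if split: if_splits)
      finally show ?thesis .
    qed
    have "(y / 2) powr \<gamma>\<^sub>0 * h powr (\<beta> * full_exponent \<gamma> j)
        \<le> (y / 2) powr full_exponent \<gamma> j * h powr (\<beta> * full_exponent \<gamma> j)"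
      by (intro mult_right_mono powr_mono lf(2)[OF j] y2) simp
    also have "\<dots> = (\<zeta> / 2) powr full_exponent \<gamma> j"
    proof -
      have "0 \<le> y / 2" using y2 by linarith
      then show ?thesis unfolding z2 by (subst powr_mult) (simp_all add: powr_powr)
    qed
    finally have pw: "(y / 2) powr \<gamma>\<^sub>0 * h powr (\<beta> * full_exponent \<gamma> j) \<le> (\<zeta> / 2) powr full_exponent \<gamma> j" .
    have "a * h ^ CARD('d) * h powr (\<beta> * full_exponent \<gamma> j) =
        (k * h ^ CARD('d)) * (C\<^sub>0 * ((y / 2) powr \<gamma>\<^sub>0 * h powr (\<beta> * full_exponent \<gamma> j)))"
      by (simp add: a_def)
    also have "\<dots> \<le> (k * h ^ CARD('d)) * ?q"
      using k0 h C0 pw by (intro mult_left_mono) auto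
    also have "\<dots> \<le> (\<integral>z. K ((fst z - x) /\<^sub>R h) \<partial>P j) * ?q"
      unfolding k_def
      by (intro mult_right_mono integral_kernel_ge[OF PF(1,4) g(2,1) A(3) _ A(4) g(3) _ h(1,3) K])
        (use A(1) const C0 in \<open>auto intro!: borel_closed compact_imp_closed\<close>)
    also have "\<dots> \<le> \<sigma> * (\<integral>z. centred_label K h x z \<partial>P j)"
      by (subst mult.commute, rule centred_label_signal[OF P[OF j] eta[OF j] K near])
    finally show ?thesis .
  qed
  have var: "(\<integral>z. (centred_label K h x z)\<^sup>2 \<partial>P j) \<le> V * h ^ CARD('d)" if j: "j \<le> m" for j
  proof -
    obtain g where g: "g \<in> borel_measurable borel"
      "covariate_law (P j) = density lborel (\<lambda>x. ennreal (g x))"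
      "\<And>x. x \<in> A \<Longrightarrow> g x \<le> g\<^sub>m\<^sub>a\<^sub>x" "\<And>x. x \<notin> A \<Longrightarrow> g x = 0"
      using dens[OF j] by blast
    have "g z \<le> g\<^sub>m\<^sub>a\<^sub>x" for z using g(3,4)[of z] const by (cases "z \<in> A") auto
    then show ?thesis
      unfolding V_def using const
      by (intro centred_label_second_moment_le[OF P[OF j] K g(2,1) _ _ h(1)]) auto
  qed
  have V0: "0 \<le> V" unfolding V_def using const by simp
  have \<sigma>1: "\<bar>\<sigma>\<bar> = 1" and \<sigma>pos: "(\<sigma> > 0) = (\<eta> 0 x \<ge> 1 / 2)" by (auto simp: \<sigma>_def)
  have ac: "a / c\<^sub>K = c * y powr \<gamma>\<^sub>0"
    unfolding a_def c_def k_def C\<^sub>0_def \<gamma>\<^sub>0_def using y2 by (simp add: powr_divide mult_ac)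
  have Vc: "V / (c\<^sub>K\<^sup>2 * ln 2) = g\<^sub>m\<^sub>a\<^sub>x * 2 ^ CARD('d) / (4 * ln 2)"
    using cK by (simp add: V_def)
  have "emeasure (data_law m n P \<Otimes>\<^sub>M N) {q \<in> space (data_law m n P \<Otimes>\<^sub>M N).
      private_classifier m \<beta> \<gamma> c\<^sub>K K n \<epsilon> \<delta> h (fst q) (\<lambda>j. \<xi> j (snd q)) x \<noteq> (\<eta> 0 x \<ge> 1 / 2)}
    \<le> ennreal (exp (1 + V / (c\<^sub>K\<^sup>2 * ln 2) - a / c\<^sub>K))"
    unfolding \<sigma>pos[symmetric]
    by (rule private_misclassification_le[OF P K N x cK _ h(1,2) const(3) srv rate \<sigma>1 sig var V0])
      (use const in auto)
  then have "measure (data_law m n P \<Otimes>\<^sub>M N) {q \<in> space (data_law m n P \<Otimes>\<^sub>M N).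
      private_classifier m \<beta> \<gamma> c\<^sub>K K n \<epsilon> \<delta> h (fst q) (\<lambda>j. \<xi> j (snd q)) x \<noteq> (\<eta> 0 x \<ge> 1 / 2)}
    \<le> exp (1 + V / (c\<^sub>K\<^sup>2 * ln 2) - a / c\<^sub>K)"
    unfolding measure_def by (rule enn2real_leI[rotated]) simp
  also have "\<dots> = exp (1 + g\<^sub>m\<^sub>a\<^sub>x * 2 ^ CARD('d) / (4 * ln 2)) * exp (- (c * y powr \<gamma>\<^sub>0))"
    unfolding ac Vc exp_add[symmetric] by simp
  finally show ?thesis unfolding y_def \<zeta>_def \<gamma>\<^sub>0_def .
qed


section \<open>Integration over the margin\<close>

lemma dyadic_cover:
  fixes y :: real
  obtains k :: nat where "y \<le> 2 ^ k" "k = 0 \<or> 2 ^ k < 2 * y"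
proof -
  obtain n where n: "y < 2 ^ n" using real_arch_pow[of 2 y] by auto
  define k where "k = (LEAST k. y \<le> 2 ^ k)"
  have k: "y \<le> 2 ^ k" unfolding k_def by (rule LeastI[of _ n]) (use n in simp)
  have "k = 0 \<or> 2 ^ k < 2 * y"
  proof (cases k)
    case (Suc l)
    then have "\<not> y \<le> 2 ^ l" using not_less_Least[of l "\<lambda>k. y \<le> 2 ^ k"] by (simp add: k_def)
    then show ?thesis using Suc by simp
  qed simp
  with k that show thesis by blast
qed

text \<open>
  Peeling. Split the space according to the dyadic size of \<open>\<zeta> / \<rho>\<close>. On the shell where it is about
  \<open>2 ^ k\<close>, the integrand is at most of order \<open>\<rho> * 2 powr (- k * (\<alpha> + 1))\<close> by the tail of \<open>\<phi>\<close>, while the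
  shell has mass of order \<open>\<rho> powr \<alpha> * 2 powr (k * \<alpha>)\<close> by the margin condition; the products form a
  geometric series. The order \<open>\<alpha> + 2\<close> of the tail is the one that leaves the ratio \<open>1 / 2\<close>.
\<close>

lemma margin_integral_le:
  fixes \<zeta> \<phi> :: "'a \<Rightarrow> real"
  assumes [measurable]: "\<zeta> \<in> borel_measurable M"
    and margin: "\<And>t. 0 < t \<Longrightarrow> emeasure M {z \<in> space M. \<zeta> z \<le> t} \<le> ennreal (C\<^sub>\<alpha> * t powr \<alpha>)"
    and pos: "0 \<le> C\<^sub>\<alpha>" "0 \<le> \<alpha>" "0 < \<rho>" "1 \<le> B"
    and phi: "AE z in M. 0 \<le> \<zeta> z \<and> \<phi> z \<le> 1 \<and> \<phi> z * (\<zeta> z / \<rho>) powr (\<alpha> + 2) \<le> B"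
  shows "(\<integral>\<^sup>+z. ennreal (\<zeta> z * \<phi> z) \<partial>M) \<le> ennreal (2 powr (\<alpha> + 2) * B * C\<^sub>\<alpha> * \<rho> powr (1 + \<alpha>))"
proof -
  define M' where "M' = 2 powr (\<alpha> + 1) * B"
  \<comment> \<open>The value \<open>w k\<close> bounds \<open>\<zeta> * \<phi>\<close> on the shell on which \<open>\<zeta> / \<rho>\<close> lies between \<open>2 ^ (k - 1)\<close> and \<open>2 ^ k\<close>; the
    factor \<open>2 powr (\<alpha> + 1)\<close> in \<open>M'\<close> pays for replacing \<open>\<zeta> / \<rho>\<close> by the upper end of its shell.\<close>
  define w where "w k = \<rho> * M' * (2 ^ k) powr (- (\<alpha> + 1))" for k :: nat
  define S where "S k = {z \<in> space M. \<zeta> z \<le> \<rho> * 2 ^ k}" for k :: nat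
  have M': "1 \<le> M'" unfolding M'_def using pos by (simp add: ge_one_powr_ge_zero mult_ge1_I)
  have w: "0 \<le> w k" for k using pos M' by (simp add: w_def)
  have [measurable]: "S k \<in> sets M" for k unfolding S_def by measurable
  have pt: "ennreal (\<zeta> z * \<phi> z) \<le> (\<Sum>k. ennreal (w k) * indicator (S k) z)"
    if z: "z \<in> space M" "0 \<le> \<zeta> z" "\<phi> z \<le> 1" "\<phi> z * (\<zeta> z / \<rho>) powr (\<alpha> + 2) \<le> B" for z
  proof -
    let ?y = "\<zeta> z / \<rho>"
    have y: "0 \<le> ?y" using z pos by simp
    obtain k where k: "?y \<le> 2 ^ k" "k = 0 \<or> 2 ^ k < 2 * ?y" by (rule dyadic_cover)
    have zS: "z \<in> S k" using k(1) z pos by (simp add: S_def divide_simps mult.commute)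
    have "?y * \<phi> z \<le> M' * (2 ^ k) powr (- (\<alpha> + 1))"
    proof (cases "k = 0")
      case True
      have "?y * \<phi> z \<le> ?y * 1" by (rule mult_left_mono[OF z(3) y])
      also have "\<dots> \<le> M'" using k(1) True M' by simp
      finally show ?thesis using True by simp
    next
      case False
      with k have lt: "2 ^ k < 2 * ?y" by simp
      have y0: "0 < ?y" using less_trans[OF _ lt, of 0] by simp
      have "(?y * \<phi> z) * ?y powr (\<alpha> + 1) = \<phi> z * ?y powr (\<alpha> + 2)"
      proof -
        have "?y powr (\<alpha> + 2) = ?y powr (\<alpha> + 1) * ?y powr 1"
          unfolding powr_add[symmetric] by (simp add: add.commute)
        then show ?thesis using y0 by (simp only: powr_one mult_ac)
      qed
      then have le: "?y * \<phi> z \<le> B / ?y powr (\<alpha> + 1)"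
        using z(4) pos_le_divide_eq[of "?y powr (\<alpha> + 1)" "?y * \<phi> z" B] y0
        by (simp only: powr_gt_zero)
      have half: "2 ^ k / 2 \<le> ?y" using lt by linarith
      note le
      also have "B / ?y powr (\<alpha> + 1) \<le> B / (2 ^ k / 2) powr (\<alpha> + 1)"
        using y0 pos by (intro divide_left_mono powr_mono2 half mult_pos_pos) auto
      also have "\<dots> = M' * (2 ^ k) powr (- (\<alpha> + 1))"
        unfolding M'_def powr_minus_divide by (simp add: powr_divide)
      finally show ?thesis .
    qed
    then have "\<zeta> z * \<phi> z \<le> w k"
      using mult_left_mono[of "?y * \<phi> z" _ \<rho>] pos by (simp add: w_def mult.assoc)
    then have "ennreal (\<zeta> z * \<phi> z) \<le> ennreal (w k) * indicator (S k) z"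
      using zS by (simp add: ennreal_leI)
    also have "\<dots> \<le> (\<Sum>k. ennreal (w k) * indicator (S k) z)"
    proof -
      have "f k \<le> suminf f" for f :: "nat \<Rightarrow> ennreal" using sum_le_suminf[of f "{k}"] by simp
      then show ?thesis .
    qed
    finally show ?thesis .
  qed
  have "(\<integral>\<^sup>+z. ennreal (\<zeta> z * \<phi> z) \<partial>M) \<le> (\<integral>\<^sup>+z. (\<Sum>k. ennreal (w k) * indicator (S k) z) \<partial>M)"
  proof (rule nn_integral_mono_AE)
    show "AE z in M. ennreal (\<zeta> z * \<phi> z) \<le> (\<Sum>k. ennreal (w k) * indicator (S k) z)"
      using phi AE_space by eventually_elim (rule pt, auto)
  qed
  also have "\<dots> = (\<Sum>k. ennreal (w k) * emeasure M (S k))"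
    by (subst nn_integral_suminf) (auto simp: nn_integral_cmult_indicator)
  also have "\<dots> \<le> (\<Sum>k. ennreal (M' * C\<^sub>\<alpha> * \<rho> powr (1 + \<alpha>) * (1 / 2) ^ k))"
  proof (intro suminf_le summableI)
    fix k
    have "ennreal (w k) * emeasure M (S k) \<le> ennreal (w k) * ennreal (C\<^sub>\<alpha> * (\<rho> * 2 ^ k) powr \<alpha>)"
      unfolding S_def by (intro mult_left_mono margin) (use pos in auto)
    also have "\<dots> = ennreal (w k * (C\<^sub>\<alpha> * (\<rho> * 2 ^ k) powr \<alpha>))"
      using w pos by (simp add: ennreal_mult)
    also have "w k * (C\<^sub>\<alpha> * (\<rho> * 2 ^ k) powr \<alpha>) =
        M' * C\<^sub>\<alpha> * (\<rho> powr 1 * \<rho> powr \<alpha>) * ((2 ^ k) powr (- (\<alpha> + 1)) * (2 ^ k) powr \<alpha>)"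
      using pos by (simp add: w_def powr_mult)
    also have "\<dots> = M' * C\<^sub>\<alpha> * \<rho> powr (1 + \<alpha>) * (1 / 2) ^ k"
      unfolding powr_add[symmetric] by (simp add: powr_minus_divide power_one_over)
    finally show "ennreal (w k) * emeasure M (S k) \<le> ennreal (M' * C\<^sub>\<alpha> * \<rho> powr (1 + \<alpha>) * (1 / 2) ^ k)" .
  qed
  also have "\<dots> = ennreal (M' * C\<^sub>\<alpha> * \<rho> powr (1 + \<alpha>) * (1 / (1 - 1 / 2)))"
    using M' pos by (intro suminf_ennreal_eq sums_mult geometric_sums) auto
  also have "M' * C\<^sub>\<alpha> * \<rho> powr (1 + \<alpha>) * (1 / (1 - 1 / 2)) = 2 powr (\<alpha> + 2) * B * C\<^sub>\<alpha> * \<rho> powr (1 + \<alpha>)"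
  proof -
    have "(2 :: real) powr (\<alpha> + 2) = 2 powr (\<alpha> + 1) * 2 powr 1"
      unfolding powr_add[symmetric] by (simp add: add.commute)
    then show ?thesis by (simp add: M'_def)
  qed
  finally show ?thesis .
qed


section \<open>The excess risk\<close>

text \<open>
  For bandwidths below the scale on which the support is regular, the excess risk is of the order that
  the margin condition assigns to the resolution \<open>h powr \<beta>\<close>. Locations whose margin is below a
  fixed multiple of that resolution are covered by the trivial bound 1 on the probability of error. The number \<open>B\<close> bounds that
  probability times the power \<open>\<alpha> + 2\<close> of the margin in units of \<open>h powr \<beta>\<close>.
\<close>

lemma excess_risk_le_bandwidth:
  fixes P :: "nat \<Rightarrow> ((real ^ 'd) \<times> bool) measure" and K :: "real ^ 'd \<Rightarrow> real"
    and \<gamma> C :: "nat \<Rightarrow> real" and m :: nat and b\<^sub>K c\<^sub>K g\<^sub>m\<^sub>i\<^sub>n g\<^sub>m\<^sub>a\<^sub>x c\<^sub>\<mu> \<alpha> \<beta> L :: real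
  defines "c \<equiv> b\<^sub>K * g\<^sub>m\<^sub>i\<^sub>n * c\<^sub>\<mu> * unit_ball_vol (real CARD('d)) / 2 ^ CARD('d) *
      Min (insert 1 (C ` {1..m})) / (c\<^sub>K * 2 powr least_exponent m \<gamma>)"
  defines "B \<equiv> 1 + (2 + 2 * L * real CARD('d) powr \<beta>) powr (\<alpha> + 2) +
      exp (1 + g\<^sub>m\<^sub>a\<^sub>x * 2 ^ CARD('d) / (4 * ln 2)) *
        ((\<alpha> + 2) / (least_exponent m \<gamma> * c)) powr ((\<alpha> + 2) / least_exponent m \<gamma>)"
  assumes cls: "P \<in> transfer_class m \<alpha> \<beta> \<gamma> L C\<^sub>\<alpha> C g\<^sub>m\<^sub>i\<^sub>n g\<^sub>m\<^sub>a\<^sub>x c\<^sub>\<mu> r\<^sub>\<mu>"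
    and const: "0 < \<beta>" "0 < L" "\<And>j. j \<in> {1..m} \<Longrightarrow> 0 < \<gamma> j" "\<And>j. j \<in> {1..m} \<Longrightarrow> 0 < C j"
      "0 < g\<^sub>m\<^sub>i\<^sub>n" "g\<^sub>m\<^sub>i\<^sub>n < g\<^sub>m\<^sub>a\<^sub>x" "0 < c\<^sub>\<mu>" "0 < b\<^sub>K" and \<alpha>: "0 \<le> \<alpha>" "0 < C\<^sub>\<alpha>"
    and K: "smoothing_kernel L\<^sub>K c\<^sub>K b\<^sub>K K" and N: "noise_processes m K h N \<xi>"
    and srv: "\<And>j. j \<le> m \<Longrightarrow> 1 \<le> n j" "\<And>j. j \<le> m \<Longrightarrow> 0 < \<epsilon> j"
      "\<And>j. j \<le> m \<Longrightarrow> 0 < \<delta> j" "\<And>j. j \<le> m \<Longrightarrow> \<delta> j < 1"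
    and rate: "rate_function CARD('d) m \<beta> \<gamma> n \<epsilon> h = ln (2 / Min (\<delta> ` {..m}))"
    and h: "0 < h" "h \<le> 1" "h \<le> 2 * r\<^sub>\<mu>"
  shows "excess_risk m n N (\<lambda>D \<omega>. private_classifier m \<beta> \<gamma> c\<^sub>K K n \<epsilon> \<delta> h D (\<lambda>j. \<xi> j \<omega>)) P
    \<le> 2 powr (\<alpha> + 2) * (2 powr (\<alpha> + 2) * B) * C\<^sub>\<alpha> * h powr (\<beta> * (1 + \<alpha>))"
proof -
  note cls' = cls[unfolded transfer_class_def mem_Collect_eq]
  have P: "labelled_law (P j)" if "j \<le> m" for j using cls' that by simp
  obtain \<eta> where eta': "\<forall>j\<le>m. regression_version (P j) (\<eta> j)"
    and sources': "\<forall>j\<in>{1..m}. \<forall>x\<in>unit_cube. sgn (\<eta> j x - 1 / 2) = sgn (\<eta> 0 x - 1 / 2) \<and>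
        \<bar>\<eta> j x - 1 / 2\<bar> \<ge> C j * \<bar>\<eta> 0 x - 1 / 2\<bar> powr \<gamma> j"
    and holder': "\<forall>x\<in>unit_cube. \<forall>x'\<in>unit_cube. \<bar>\<eta> 0 x - \<eta> 0 x'\<bar> \<le> L * norm (x - x') powr \<beta>"
    and margin: "\<forall>t>0. measure (covariate_law (P 0))
        {x \<in> unit_cube. 0 \<le> \<bar>\<eta> 0 x - 1 / 2\<bar> \<and> \<bar>\<eta> 0 x - 1 / 2\<bar> \<le> t} \<le> C\<^sub>\<alpha> * t powr \<alpha>"
    using conjunct1[OF conjunct2[OF cls']] by (elim exE conjE) (rule that)
  have eta: "regression_version (P j) (\<eta> j)" if "j \<le> m" for j using eta' that by simp
  have sources: "sgn (\<eta> j y - 1 / 2) = sgn (\<eta> 0 y - 1 / 2) \<and>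
      \<bar>\<eta> j y - 1 / 2\<bar> \<ge> C j * \<bar>\<eta> 0 y - 1 / 2\<bar> powr \<gamma> j" if "j \<in> {1..m}" "y \<in> unit_cube" for j y
    using bspec[OF bspec[OF sources' that(1)] that(2)] .
  have holder: "\<bar>\<eta> 0 y - \<eta> 0 y'\<bar> \<le> L * norm (y - y') powr \<beta>"
    if "y \<in> unit_cube" "y' \<in> unit_cube" for y y'
    using bspec[OF bspec[OF holder' that(1)] that(2)] .
  obtain A where A: "compact A" "A \<subseteq> unit_cube" "regular_set c\<^sub>\<mu> r\<^sub>\<mu> A"
    and dens': "\<forall>j\<le>m. measure_support (covariate_law (P j)) = A \<and> (\<exists>g \<in> borel_measurable borel.
        covariate_law (P j) = density lborel (\<lambda>x. ennreal (g x)) \<and>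
        (\<forall>x\<in>A. g\<^sub>m\<^sub>i\<^sub>n \<le> g x \<and> g x \<le> g\<^sub>m\<^sub>a\<^sub>x) \<and> (\<forall>x. x \<notin> A \<longrightarrow> g x = 0))"
    using conjunct2[OF conjunct2[OF cls']] by (elim exE conjE) (rule that)
  have dens: "\<exists>g \<in> borel_measurable borel. covariate_law (P j) = density lborel (\<lambda>x. ennreal (g x)) \<and>
      (\<forall>x\<in>A. g\<^sub>m\<^sub>i\<^sub>n \<le> g x \<and> g x \<le> g\<^sub>m\<^sub>a\<^sub>x) \<and> (\<forall>x. x \<notin> A \<longrightarrow> g x = 0)" if "j \<le> m" for j
    using dens'[rule_format, OF that] by (rule conjunct2)
  define Q where "Q = data_law m n P \<Otimes>\<^sub>M N"
  define err where "err x = measure Q {q \<in> space Q.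
      private_classifier m \<beta> \<gamma> c\<^sub>K K n \<epsilon> \<delta> h (fst q) (\<lambda>j. \<xi> j (snd q)) x \<noteq> (\<eta> 0 x \<ge> 1 / 2)}" for x
  \<comment> \<open>The margin is doubled so that the factor 2 of the excess risk is absorbed.\<close>
  define \<zeta> where "\<zeta> z = 2 * \<bar>\<eta> 0 (fst z) - 1 / 2\<bar>" for z :: "(real ^ 'd) \<times> bool"
  have P0: "labelled_law (P 0)" and eta0: "regression_version (P 0) (\<eta> 0)" using P eta by auto
  note PF = labelled_law_facts[OF P0]
  note [measurable] = PF(3,4)
  have em[measurable]: "\<eta> 0 \<in> borel_measurable cube_borel"
    using eta0 by (simp add: regression_version_def)
  have N': "prob_space N" using N by (simp add: noise_processes_def)
  interpret D: prob_space "data_law m n P"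
    by (rule prob_space_data_law) (rule P)
  interpret N: prob_space N by (rule N')
  interpret DN: pair_prob_space "data_law m n P" N ..
  interpret P0: prob_space "P 0" by (rule PF)
  have cK: "0 < c\<^sub>K" using smoothing_kernel_facts(6)[OF K] const(8) by linarith
  have err01: "0 \<le> err x" "err x \<le> 1" for x
    unfolding err_def Q_def by (auto intro: DN.prob_le_1)
  have g0: "0 < least_exponent m \<gamma>" by (rule least_exponent_facts(1)) (use const(3) in blast)
  have c0: "0 < c"
    unfolding c_def using const cK
    by (intro divide_pos_pos mult_pos_pos) auto
  have B1: "1 \<le> B" unfolding B_def by simp
  have hb: "0 < h powr \<beta>" using h by simp
  have tail: "err x * (2 * \<bar>\<eta> 0 x - 1 / 2\<bar> / h powr \<beta>) powr (\<alpha> + 2) \<le> 2 powr (\<alpha> + 2) * B"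
    if x: "x \<in> A" for x
  proof -
    define y where "y = \<bar>\<eta> 0 x - 1 / 2\<bar> / h powr \<beta>"
    have y0: "0 \<le> y" using hb by (simp add: y_def)
    have "err x * y powr (\<alpha> + 2) \<le> B"
    proof (cases "2 + 2 * L * real CARD('d) powr \<beta> \<le> y")
      case True
      then have "(2 + 2 * L * real CARD('d) powr \<beta>) * h powr \<beta> \<le> \<bar>\<eta> 0 x - 1 / 2\<bar>"
        using hb by (simp add: y_def pos_le_divide_eq)
      from misclassification_tail[OF P eta sources holder A x dens const K N srv rate h this]
      have "err x \<le> exp (1 + g\<^sub>m\<^sub>a\<^sub>x * 2 ^ CARD('d) / (4 * ln 2)) * exp (- (c * y powr least_exponent m \<gamma>))"
        by (simp only: err_def Q_def y_def c_def)
      then have "err x * y powr (\<alpha> + 2) \<le> exp (1 + g\<^sub>m\<^sub>a\<^sub>x * 2 ^ CARD('d) / (4 * ln 2)) *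
          (exp (- (c * y powr least_exponent m \<gamma>)) * y powr (\<alpha> + 2))"
        unfolding mult.assoc[symmetric] by (rule mult_right_mono) simp
      also have "\<dots> \<le> exp (1 + g\<^sub>m\<^sub>a\<^sub>x * 2 ^ CARD('d) / (4 * ln 2)) *
          ((\<alpha> + 2) / (least_exponent m \<gamma> * c)) powr ((\<alpha> + 2) / least_exponent m \<gamma>)"
        using \<alpha> by (intro mult_left_mono stretched_exp_times_powr_le c0 g0 y0) auto
      also have "\<dots> \<le> B" by (simp add: B_def)
      finally show ?thesis .
    next
      case False
      have "err x * y powr (\<alpha> + 2) \<le> 1 * (2 + 2 * L * real CARD('d) powr \<beta>) powr (\<alpha> + 2)"
        using False y0 \<alpha> err01 by (intro mult_mono powr_mono2) auto
      also have "\<dots> \<le> B" by (simp add: B_def)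
      finally show ?thesis .
    qed
    moreover have "(2 * \<bar>\<eta> 0 x - 1 / 2\<bar> / h powr \<beta>) powr (\<alpha> + 2) = 2 powr (\<alpha> + 2) * y powr (\<alpha> + 2)"
      using y0 powr_mult[of 2 y "\<alpha> + 2"] by (simp add: y_def)
    ultimately show ?thesis by (simp add: mult.left_commute)
  qed
  obtain g where g: "g \<in> borel_measurable borel"
    "covariate_law (P 0) = density lborel (\<lambda>x. ennreal (g x))" "\<And>x. x \<notin> A \<Longrightarrow> g x = 0"
    using dens[of 0] by blast
  have inA: "AE z in P 0. fst z \<in> A"
    by (rule AE_covariate_mem[OF PF(4) g(2,1) _ g(3)]) (use A(1) in \<open>auto intro!: borel_closed compact_imp_closed\<close>)
  have marg: "emeasure (P 0) {z \<in> space (P 0). \<zeta> z \<le> t} \<le> ennreal (C\<^sub>\<alpha> * t powr \<alpha>)" if t: "0 < t" for t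
  proof -
    let ?S = "{x \<in> unit_cube. 0 \<le> \<bar>\<eta> 0 x - 1 / 2\<bar> \<and> \<bar>\<eta> 0 x - 1 / 2\<bar> \<le> t / 2}"
    have "{x \<in> space cube_borel. \<bar>\<eta> 0 x - 1 / 2\<bar> \<le> t / 2} \<in> sets cube_borel" by measurable
    then have S: "?S \<in> sets borel"
      by (subst (asm) sets_restrict_space_iff) (auto simp: space_restrict_space)
    have "measure (P 0) {z \<in> space (P 0). \<zeta> z \<le> t} = measure (covariate_law (P 0)) ?S"
      unfolding covariate_law_def measure_distr[OF PF(4) S]
      by (rule arg_cong[where f = "measure (P 0)"]) (auto simp: PF(2) \<zeta>_def)
    also have "\<dots> \<le> C\<^sub>\<alpha> * (t / 2) powr \<alpha>" using margin[rule_format, of "t / 2"] t by simp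
    also have "\<dots> \<le> C\<^sub>\<alpha> * t powr \<alpha>" using t \<alpha> by (intro mult_left_mono powr_mono2) auto
    finally show ?thesis by (simp add: P0.emeasure_eq_measure ennreal_leI)
  qed
  have "ennreal (excess_risk m n N (\<lambda>D \<omega>. private_classifier m \<beta> \<gamma> c\<^sub>K K n \<epsilon> \<delta> h D (\<lambda>j. \<xi> j \<omega>)) P) =
      (\<integral>\<^sup>+z. ennreal (\<zeta> z * err (fst z)) \<partial>P 0)"
    unfolding \<zeta>_def err_def Q_def
  proof (rule excess_risk_eq)
    show "(\<lambda>((D, \<omega>), x). private_classifier m \<beta> \<gamma> c\<^sub>K K n \<epsilon> \<delta> h D (\<lambda>j. \<xi> j \<omega>) x)
      \<in> measurable ((data_law m n P \<Otimes>\<^sub>M N) \<Otimes>\<^sub>M cube_borel) (count_space UNIV)"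
      by (rule measurable_private_classifier[OF _ K N]) (rule P)
  qed (use P eta0 N' in auto)
  also have "\<dots> \<le> ennreal (2 powr (\<alpha> + 2) * (2 powr (\<alpha> + 2) * B) * C\<^sub>\<alpha> * (h powr \<beta>) powr (1 + \<alpha>))"
  proof (rule margin_integral_le[OF _ marg])
    show "\<zeta> \<in> borel_measurable (P 0)" unfolding \<zeta>_def by measurable
    show "1 \<le> 2 powr (\<alpha> + 2) * B"
      using B1 \<alpha> by (intro mult_ge1_I ge_one_powr_ge_zero) auto
    show "AE z in P 0. 0 \<le> \<zeta> z \<and> err (fst z) \<le> 1 \<and>
        err (fst z) * (\<zeta> z / h powr \<beta>) powr (\<alpha> + 2) \<le> 2 powr (\<alpha> + 2) * B"
      using inA by eventually_elim (use tail err01 in \<open>auto simp: \<zeta>_def\<close>)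
  qed (use \<alpha> hb in auto)
  finally show ?thesis
    using B1 \<alpha> by (subst (asm) ennreal_le_iff) (auto simp: powr_powr)
qed

theorem theorem4p2:
  fixes m :: nat and \<alpha> \<beta> L C\<^sub>\<alpha> g\<^sub>m\<^sub>i\<^sub>n g\<^sub>m\<^sub>a\<^sub>x c\<^sub>\<mu> r\<^sub>\<mu> L\<^sub>K c\<^sub>K b\<^sub>K \<Delta> :: real
    and \<gamma> C :: "nat \<Rightarrow> real"
  assumes "0 \<le> \<alpha>" and "0 < \<beta>" and "\<beta> \<le> 1" and "\<alpha> * \<beta> \<le> real CARD('d::finite)"
    and "0 < L" and "0 < C\<^sub>\<alpha>"
    and "\<And>j. j \<in> {1..m} \<Longrightarrow> 0 < \<gamma> j" and "\<And>j. j \<in> {1..m} \<Longrightarrow> 0 < C j"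
    and "0 < g\<^sub>m\<^sub>i\<^sub>n" and "g\<^sub>m\<^sub>i\<^sub>n < g\<^sub>m\<^sub>a\<^sub>x" and "0 < c\<^sub>\<mu>" and "0 < r\<^sub>\<mu>"
    and "0 < b\<^sub>K"
    and "\<Delta> < 1"
  shows "\<exists>C\<^sub>0>0. \<forall>(n :: nat \<Rightarrow> nat) (\<epsilon> :: nat \<Rightarrow> real) (\<delta> :: nat \<Rightarrow> real)
           (K :: real ^ 'd \<Rightarrow> real) (h :: real) (r :: real)
           (N :: 'w measure) (\<xi> :: nat \<Rightarrow> 'w \<Rightarrow> real ^ 'd \<Rightarrow> real).
     (\<forall>j\<le>m. 1 \<le> n j \<and> 0 < \<epsilon> j \<and> 0 < \<delta> j \<and> \<delta> j < 1) \<longrightarrow>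
     Min (\<delta> ` {..m}) \<le> \<Delta> \<longrightarrow>
     smoothing_kernel L\<^sub>K c\<^sub>K b\<^sub>K K \<longrightarrow>
     0 < h \<longrightarrow> rate_function CARD('d) m \<beta> \<gamma> n \<epsilon> h = ln (2 / Min (\<delta> ` {..m})) \<longrightarrow>
     0 < r \<longrightarrow> rate_function CARD('d) m \<beta> \<gamma> n \<epsilon> r = 1 \<longrightarrow>
     noise_processes m K h N \<xi> \<longrightarrow>
     (SUP P \<in> transfer_class m \<alpha> \<beta> \<gamma> L C\<^sub>\<alpha> C g\<^sub>m\<^sub>i\<^sub>n g\<^sub>m\<^sub>a\<^sub>x c\<^sub>\<mu> r\<^sub>\<mu>.
        ereal (excess_risk m n N
          (\<lambda>D \<omega>. private_classifier m \<beta> \<gamma> c\<^sub>K K n \<epsilon> \<delta> h D (\<lambda>j. \<xi> j \<omega>)) P))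
     \<le> ereal (C\<^sub>0 * r powr (\<beta> * (1 + \<alpha>)) *
          ln (1 / Min (\<delta> ` {..m})) powr
            (\<beta> * (1 + \<alpha>) / (2 * \<beta> * Min (insert 1 (\<gamma> ` {1..m})) + real CARD('d))))"
proof -
  define q where "q = \<beta> * (1 + \<alpha>)"
  define p where "p = 2 * \<beta> * least_exponent m \<gamma> + real CARD('d)"
  \<comment> \<open>Above this bandwidth the trivial bound 1 on the excess risk is already of the right order.\<close>
  define h\<^sub>0 where "h\<^sub>0 = min 1 (2 * r\<^sub>\<mu>)"
  \<comment> \<open>The constant of \<open>excess_risk_le_bandwidth\<close>; \<open>M'\<close> also covers the bandwidths above \<open>h\<^sub>0\<close>.\<close>
  define M where "M = 2 powr (\<alpha> + 2) * (2 powr (\<alpha> + 2) * (1 + (2 + 2 * L * real CARD('d) powr \<beta>) powr (\<alpha> + 2) +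
      exp (1 + g\<^sub>m\<^sub>a\<^sub>x * 2 ^ CARD('d) / (4 * ln 2)) *
        ((\<alpha> + 2) / (least_exponent m \<gamma> * (b\<^sub>K * g\<^sub>m\<^sub>i\<^sub>n * c\<^sub>\<mu> * unit_ball_vol (real CARD('d)) / 2 ^ CARD('d) *
      Min (insert 1 (C ` {1..m})) / (c\<^sub>K * 2 powr least_exponent m \<gamma>)))) powr ((\<alpha> + 2) / least_exponent m \<gamma>))) * C\<^sub>\<alpha>"
  define M' where "M' = M + 1 / h\<^sub>0 powr q"
  \<comment> \<open>Lies in \<open>(0, 1)\<close> whatever the sign of \<open>\<Delta>\<close>, so that \<open>ln (1 / \<Delta>')\<close> is positive.\<close>
  define \<Delta>' where "\<Delta>' = max \<Delta> (1 / 2)"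
  define C\<^sub>0 where "C\<^sub>0 = M' * (1 + 1 / ln (1 / \<Delta>')) powr (q / p)"
  have q: "0 \<le> q" using assms by (simp add: q_def)
  have h0: "0 < h\<^sub>0" using assms by (simp add: h\<^sub>0_def)
  have M: "0 \<le> M" unfolding M_def using assms(6) by (intro mult_nonneg_nonneg add_nonneg_nonneg) auto
  have M': "0 < M'" unfolding M'_def using M h0 by (intro add_nonneg_pos) auto
  have "0 < ln (1 / \<Delta>')" using assms by (intro ln_gt_zero) (auto simp: \<Delta>'_def divide_simps max_def)
  then have "0 < 1 + 1 / ln (1 / \<Delta>')" by (simp add: add_pos_pos)
  then have C0: "0 < C\<^sub>0" unfolding C\<^sub>0_def using M' by simp
  show ?thesis
  proof (intro exI[of _ C\<^sub>0] conjI C0 allI impI SUP_least, unfold ereal_less_eq)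
    fix n :: "nat \<Rightarrow> nat" and \<epsilon> \<delta> :: "nat \<Rightarrow> real" and K :: "real ^ 'd \<Rightarrow> real" and h r :: real
      and N :: "'w measure" and \<xi> :: "nat \<Rightarrow> 'w \<Rightarrow> real ^ 'd \<Rightarrow> real"
      and P :: "nat \<Rightarrow> ((real ^ 'd) \<times> bool) measure"
    assume srv: "\<forall>j\<le>m. 1 \<le> n j \<and> 0 < \<epsilon> j \<and> 0 < \<delta> j \<and> \<delta> j < 1"
      and \<delta>: "Min (\<delta> ` {..m}) \<le> \<Delta>" and K: "smoothing_kernel L\<^sub>K c\<^sub>K b\<^sub>K K"
      and h: "0 < h" and rate: "rate_function CARD('d) m \<beta> \<gamma> n \<epsilon> h = ln (2 / Min (\<delta> ` {..m}))"
      and r: "0 < r" "rate_function CARD('d) m \<beta> \<gamma> n \<epsilon> r = 1"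
      and N: "noise_processes m K h N \<xi>"
      and P: "P \<in> transfer_class m \<alpha> \<beta> \<gamma> L C\<^sub>\<alpha> C g\<^sub>m\<^sub>i\<^sub>n g\<^sub>m\<^sub>a\<^sub>x c\<^sub>\<mu> r\<^sub>\<mu>"
    let ?E = "excess_risk m n N (\<lambda>D \<omega>. private_classifier m \<beta> \<gamma> c\<^sub>K K n \<epsilon> \<delta> h D (\<lambda>j. \<xi> j \<omega>)) P"
    have dmin: "0 < Min (\<delta> ` {..m})" using srv by (auto simp: Min_gr_iff)
    have "?E \<le> M' * h powr q"
    proof (cases "h \<le> h\<^sub>0")
      case True
      have "?E \<le> M * h powr q"
        unfolding M_def q_def
        by (rule excess_risk_le_bandwidth[OF P assms(2,5,7-11,13,1,6) K N _ _ _ _ rate h])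
          (use srv True in \<open>auto simp: h\<^sub>0_def\<close>)
      also have "\<dots> \<le> M' * h powr q"
        by (intro mult_right_mono) (auto simp: M'_def)
      finally show ?thesis .
    next
      case False
      have "?E \<le> 1"
        by (rule excess_risk_le_1) (use P N in \<open>auto simp: transfer_class_def noise_processes_def\<close>)
      also have "1 \<le> 1 / h\<^sub>0 powr q * h powr q"
        using False h0 q powr_mono2[of q h\<^sub>0 h] by (simp add: divide_simps)
      also have "\<dots> \<le> M' * h powr q" using M by (intro mult_right_mono) (auto simp: M'_def)
      finally show ?thesis .
    qed
    also have "\<dots> \<le> M' * ((1 + 1 / ln (1 / \<Delta>')) powr (q / p) *
        (r powr q * ln (1 / Min (\<delta> ` {..m})) powr (q / p)))"
      unfolding p_def
      by (intro mult_left_mono bandwidth_powr_le[OF rate r(2) h r(1) _ _ q assms(7) dmin])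
        (use assms \<delta> M' in \<open>auto simp: \<Delta>'_def\<close>)
    finally show "?E \<le> C\<^sub>0 * r powr (\<beta> * (1 + \<alpha>)) * ln (1 / Min (\<delta> ` {..m})) powr
        (\<beta> * (1 + \<alpha>) / (2 * \<beta> * Min (insert 1 (\<gamma> ` {1..m})) + real CARD('d)))"
      by (simp only: C\<^sub>0_def q_def p_def mult.assoc)
  qed
qed

end
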